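(* Let $m>1$, $N\ge 2$, and $\chi>C_N$. Let $X_0\in\mathcal R^N$ and let $X$ be the maximal solution in $\mathcal R^N$, defined on $[0,T)$, of the gradient flow system with $X(0)=X_0$. Then: (1) If $\chi\neq C_p$ for every integer $p\in[1,N-1]$, then $X$ blows up in finite time (in particular $T<+\infty$). (2) If there exists an integer $p\in[1,N-1]$ with $\chi=C_p$, then either $X$ blows up in finite time, or $T=+\infty$ and the renormalized trajectory $Y=X/|X|$ blows up in infinite time, i.e. there are an index $i_0$ and times $t_n\to+\infty$ with $Y_{i_0+1}(t_n)-Y_{i_0}(t_n)\to0$. Moreover, in the latter case, any relative blow-up set $\mathcal I$ of a sequence $(Y(t_n))$ with $t_n\to\infty$ (obtained after extraction of a subsequence) contains exactly $p$ indices, and the restriction of $Y(t_n)$ to $\mathcal I$, after renormalization (i.e. its limit profile $Z\in\mathcal R^p$), is the unique (with this normalization) critical point of $\mathcal F^p_m$ in $\mathcal R^p$.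
   Context: $\mathcal R^p=\{X\in\mathbb R^p: X_1<\dots<X_p,\ \sum_iX_i=0\}$; $|\cdot|$ is the Euclidean norm. For $p\ge2$, $\mathcal F^p_m(X)=\frac1{m-1}\sum_{i=1}^{p-1}(X_{i+1}-X_i)^{1-m}-\frac{\chi}{m-1}\sum_{1\le i\ne j\le p}|X_i-X_j|^{1-m}$ on $\mathcal R^p$, and $C_p>0$ is defined by $\frac1{C_p}=\max_{X\in\mathcal R^p}\frac{\sum_{1\le i\ne j\le p}|X_j-X_i|^{1-m}}{\sum_{i=1}^{p-1}(X_{i+1}-X_i)^{1-m}}$ (for $p=1$ these sums are empty, so no finite value $C_1$ arises). Gradient flow system: for $i=1,\dots,N$, $\dot X_i=-(X_{i+1}-X_i)^{-m}+(X_i-X_{i-1})^{-m}+2\chi\sum_{j\ne i}\mathrm{sign}(j-i)|X_j-X_i|^{-m}$, where the first term is absent for $i=N$ and the second for $i=1$; this is $\dot X=-\nabla\mathcal F^N_m(X)$. Blow-up: $X$ blows up (at its maximal time $T$) if there exist an index $i_0$ and $t_n\to T$ with $X_{i_0+1}(t_n)-X_{i_0}(t_n)\to0$; "in finite time" means moreover $T<\infty$. Relative blow-up set of a sequence $(X^n)$ in $\mathcal R^N$: a set $\mathcal I=[l,r]$ of consecutive integers in $[1,N]$, with $\mathcal J=[l,r-1]$ and $\partial\mathcal J=(\{l-1\}\cup\{r\})\cap[1,N-1]$, such that (i) $X^n_{i+1}-X^n_i\to0$ for all $i\in\mathcal J$; (ii) for all $i\in\mathcal J$ and $k\in[1,N-1]$,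 $\lim_n\frac{X^n_{i+1}-X^n_i}{X^n_{k+1}-X^n_k}$ exists and is finite; (iii) for all $i\in\mathcal J$ and $j\in\partial\mathcal J$, $\lim_n\frac{X^n_{i+1}-X^n_i}{X^n_{j+1}-X^n_j}=0$. Limit profile: with $p=|\mathcal I|$ and $\Pi_{\mathcal I}(X^n)=\big(\sum_{i\in\mathcal J}(X^n_{i+1}-X^n_i)^2\big)^{1/2}$, it is the unique $Z\in\mathcal R^p$ whose consecutive gaps (indexed by $\mathcal J$) are $\lim_n (X^n_{i+1}-X^n_i)/\Pi_{\mathcal I}(X^n)>0$. *)

theory Defs
  imports "HOL-Analysis.Analysis"
begin

text \<open>Vectors of R^p are functions nat => real, indexed by 1..p, and zero outside 1..p.\<close>

definition gap :: "(nat \<Rightarrow> real) \<Rightarrow> nat \<Rightarrow> real" where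
  "gap X i = X (Suc i) - X i"

definition Rset :: "nat \<Rightarrow> (nat \<Rightarrow> real) \<Rightarrow> bool" where
  "Rset p X \<longleftrightarrow> (\<forall>i\<in>{1..<p}. X i < X (Suc i)) \<and> (\<Sum>i=1..p. X i) = 0
      \<and> (\<forall>i. i \<notin> {1..p} \<longrightarrow> X i = 0)"

definition vnorm :: "nat \<Rightarrow> (nat \<Rightarrow> real) \<Rightarrow> real" where
  "vnorm p X = sqrt (\<Sum>i=1..p. (X i)^2)"

definition Fm :: "nat \<Rightarrow> real \<Rightarrow> real \<Rightarrow> (nat \<Rightarrow> real) \<Rightarrow> real" where
  "Fm p m chi X = 1 / (m - 1) * (\<Sum>i=1..<p. gap X i powr (1 - m))
     - chi / (m - 1) * (\<Sum>i\<in>{1..p}. \<Sum>j\<in>{1..p} - {i}. \<bar>X i - X j\<bar> powr (1 - m))"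

definition ratio :: "nat \<Rightarrow> real \<Rightarrow> (nat \<Rightarrow> real) \<Rightarrow> real" where
  "ratio p m X = (\<Sum>i\<in>{1..p}. \<Sum>j\<in>{1..p} - {i}. \<bar>X j - X i\<bar> powr (1 - m))
                 / (\<Sum>i=1..<p. gap X i powr (1 - m))"

definition Cconst :: "nat \<Rightarrow> real \<Rightarrow> real" where
  "Cconst p m = 1 / Sup (ratio p m ` {X. Rset p X})"

definition rhs :: "nat \<Rightarrow> real \<Rightarrow> real \<Rightarrow> (nat \<Rightarrow> real) \<Rightarrow> nat \<Rightarrow> real" where
  "rhs N m chi X i =
     (if i < N then - (gap X i powr (- m)) else 0)
   + (if 1 < i then gap X (i - 1) powr (- m) else 0)
   + 2 * chi * (\<Sum>j\<in>{1..N} - {i}. sgn (real j - real i) * \<bar>X j - X i\<bar> powr (- m))"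

definition is_solution ::
  "nat \<Rightarrow> real \<Rightarrow> real \<Rightarrow> (nat \<Rightarrow> real) \<Rightarrow> ereal \<Rightarrow> (real \<Rightarrow> nat \<Rightarrow> real) \<Rightarrow> bool" where
  "is_solution N m chi X0 T X \<longleftrightarrow> 0 < T \<and> X 0 = X0
     \<and> (\<forall>t. 0 \<le> t \<and> ereal t < T \<longrightarrow> Rset N (X t))
     \<and> (\<forall>t i. 0 \<le> t \<and> ereal t < T \<and> i \<in> {1..N} \<longrightarrow>
          ((\<lambda>s. X s i) has_real_derivative rhs N m chi (X t) i)
            (at t within {s. 0 \<le> s \<and> ereal s < T}))"

definition maximal_solution ::
  "nat \<Rightarrow> real \<Rightarrow> real \<Rightarrow> (nat \<Rightarrow> real) \<Rightarrow> ereal \<Rightarrow> (real \<Rightarrow> nat \<Rightarrow> real) \<Rightarrow> bool" where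
  "maximal_solution N m chi X0 T X \<longleftrightarrow> is_solution N m chi X0 T X
     \<and> (\<forall>S Y. is_solution N m chi X0 S Y \<longrightarrow> S \<le> T)"

definition blows_up :: "nat \<Rightarrow> ereal \<Rightarrow> (real \<Rightarrow> nat \<Rightarrow> real) \<Rightarrow> bool" where
  "blows_up N T X \<longleftrightarrow> (\<exists>i0\<in>{1..<N}. \<exists>tn :: nat \<Rightarrow> real.
      (\<forall>n. 0 \<le> tn n \<and> ereal (tn n) < T) \<and> (\<lambda>n. ereal (tn n)) \<longlonglongrightarrow> T
      \<and> (\<lambda>n. gap (X (tn n)) i0) \<longlonglongrightarrow> 0)"

definition renorm :: "nat \<Rightarrow> (real \<Rightarrow> nat \<Rightarrow> real) \<Rightarrow> real \<Rightarrow> nat \<Rightarrow> real" where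
  "renorm N X t = (\<lambda>i. X t i / vnorm N (X t))"

text \<open>Relative blow-up set I = [l,r] (with J = [l,r-1] nonempty) of a sequence Xs.\<close>
definition rel_blowup_set :: "nat \<Rightarrow> (nat \<Rightarrow> nat \<Rightarrow> real) \<Rightarrow> nat \<Rightarrow> nat \<Rightarrow> bool" where
  "rel_blowup_set N Xs l r \<longleftrightarrow> 1 \<le> l \<and> l < r \<and> r \<le> N
     \<and> (\<forall>i\<in>{l..<r}. (\<lambda>n. gap (Xs n) i) \<longlonglongrightarrow> 0)
     \<and> (\<forall>i\<in>{l..<r}. \<forall>k\<in>{1..<N}. \<exists>L. (\<lambda>n. gap (Xs n) i / gap (Xs n) k) \<longlonglongrightarrow> L)
     \<and> (\<forall>i\<in>{l..<r}. \<forall>j\<in>({l - 1, r} \<inter> {1..<N}).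
          (\<lambda>n. gap (Xs n) i / gap (Xs n) j) \<longlonglongrightarrow> 0)"

definition PiI :: "(nat \<Rightarrow> nat \<Rightarrow> real) \<Rightarrow> nat \<Rightarrow> nat \<Rightarrow> nat \<Rightarrow> real" where
  "PiI Xs l r n = sqrt (\<Sum>i\<in>{l..<r}. (gap (Xs n) i)^2)"

definition limit_profile :: "(nat \<Rightarrow> nat \<Rightarrow> real) \<Rightarrow> nat \<Rightarrow> nat \<Rightarrow> (nat \<Rightarrow> real) \<Rightarrow> bool" where
  "limit_profile Xs l r Z \<longleftrightarrow> Rset (r - l + 1) Z
     \<and> (\<forall>k\<in>{1..<r - l + 1}. (\<lambda>n. gap (Xs n) (l + k - 1) / PiI Xs l r n) \<longlonglongrightarrow> gap Z k)"

definition critical_point :: "nat \<Rightarrow> real \<Rightarrow> real \<Rightarrow> (nat \<Rightarrow> real) \<Rightarrow> bool" where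
  "critical_point p m chi Z \<longleftrightarrow> Rset p Z
     \<and> (\<forall>k\<in>{1..p}. ((\<lambda>s. Fm p m chi (Z(k := s))) has_real_derivative 0) (at (Z k)))"

definition gap_normalized :: "nat \<Rightarrow> (nat \<Rightarrow> real) \<Rightarrow> bool" where
  "gap_normalized p Z \<longleftrightarrow> (\<Sum>k\<in>{1..<p}. (gap Z k)^2) = 1"

end

theory Submission
  imports Defs "HOL-Probability.Discrete_Topology"
begin

text \<open>Suppose that $\chi > C_N$ and that the solution is global. By homogeneity
  $\frac{d}{dt}|X|^2 = 2(m-1)F(X)$, so the decreasing energy $F(X)$ can never become negative.
  Fix a reference configuration $X^*$ with $F(X^*) < 0$, with gaps $x_i$. For any $Y$ with
  gaps $y_i$, pairing the gradient at $Y$ with the vector $v$ whose gaps are $x_i^{1-m} y_i^m$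
  and applying Jensen's inequality to each interaction gives
  $\langle v, -\nabla F(Y)\rangle \le (m-1) F(X^*) < 0$. If $F(Y) \ge 0$, this bounds the component of
  $\nabla F(Y)$ tangent to the sphere from below by a multiple of $|Y|^{-m}$. Hence
  $G = |X|^{m-1} F(X)$, the energy of $X/|X|$, satisfies $G' \le -\kappa |X|^{-m-1}$, while
  $|X|^{m+1}$ grows at most linearly, so $G$ becomes negative, a contradiction. Therefore
  $T < \infty$ in every case, and the second alternative in the case $\chi = C_p$ never
  occurs. At a finite maximal time some gap has to vanish, as otherwise a local existence time
  that depends only on a lower bound of the gaps would continue the solution beyond $T$.\<close>

section \<open>The energy along the flow\<close>

lemma Rset_gap_pos:
  assumes "Rset p X" "i \<in> {1..<p}"
  shows "0 < gap X i"
  using assms unfolding Rset_def gap_def by auto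

lemma Rset_strict_mono:
  assumes "Rset p X" "1 \<le> i" "i < j" "j \<le> p"
  shows "X i < X j"
  using assms(3,4)
proof (induction j)
  case (Suc n)
  have "X n < X (Suc n)"
    using assms(1,2) Suc.prems unfolding Rset_def by auto
  moreover have "X i \<le> X n"
    using Suc by (cases "i = n") auto
  ultimately show ?case by simp
qed simp

lemma Rset_inj:
  assumes "Rset p X" "i \<in> {1..p}" "j \<in> {1..p}" "i \<noteq> j"
  shows "X i \<noteq> X j"
  using Rset_strict_mono[OF assms(1), of i j] Rset_strict_mono[OF assms(1), of j i] assms
  by (cases i j rule: linorder_cases) auto

lemma sgn_index_mult_diff:
  assumes "Rset p X" "i \<in> {1..p}" "j \<in> {1..p}"
  shows "sgn (real j - real i) * (X j - X i) = \<bar>X j - X i\<bar>"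
  using Rset_strict_mono[OF assms(1), of i j] Rset_strict_mono[OF assms(1), of j i] assms
  by (cases i j rule: linorder_cases) auto

lemma sum_gap:
  assumes "i \<le> j"
  shows "(\<Sum>k=i..<j. gap X k) = X j - X i"
  using assms by (simp add: gap_def sum_Suc_diff')

lemma Rset_sum_squares_pos:
  assumes "Rset N X" "N \<ge> 2"
  shows "0 < (\<Sum>i=1..N. (X i)\<^sup>2)"
proof -
  have "X 1 < X 2"
    using Rset_strict_mono[OF assms(1), of 1 2] assms(2) by simp
  then have "X 1 \<noteq> 0 \<or> X 2 \<noteq> 0" by auto
  then obtain k where "k \<in> {1..N}" "X k \<noteq> 0"
    using assms(2) by (metis atLeastAtMost_iff le_refl one_le_numeral order.trans)
  then show ?thesis
    by (intro sum_pos2[of _ k]) auto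
qed

section \<open>Gradient structure and homogeneity of the energy\<close>

text \<open>Summation by parts turns the local terms into gaps of \<open>v\<close>; antisymmetry of
  the kernel symmetrises the interaction and absorbs the factor 2. Only differences of
  \<open>v\<close> remain. Suitable choices of \<open>v\<close> yield conservation of the centre of
  mass, Euler's identity, the energy derivative and the Jensen bound.\<close>

lemma rhs_pairing:
  "(\<Sum>i=1..N. v i * rhs N m chi Y i) =
     (\<Sum>i=1..<N. gap v i * gap Y i powr (- m))
     - chi * (\<Sum>i\<in>{1..N}. \<Sum>j\<in>{1..N} - {i}.
                 sgn (real j - real i) * (v j - v i) * \<bar>Y j - Y i\<bar> powr (- m))"
proof -
  define a where "a i = gap Y i powr (- m)" for i
  define K where "K i j = sgn (real j - real i) * \<bar>Y j - Y i\<bar> powr (- m)" for i j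
  have loc: "(\<Sum>i=1..n. v i * ((if i < n then - a i else 0) + (if 1 < i then a (i - 1) else 0)))
      = (\<Sum>i=1..<n. gap v i * a i)" for n
  proof (cases n)
    case (Suc k)
    have "(\<Sum>i=1..n. v i * (if i < n then - a i else 0)) = - (\<Sum>i=1..<n. v i * a i)"
      unfolding Suc sum_negf[symmetric]
      by (intro sum.mono_neutral_cong_right) auto
    moreover have "(\<Sum>i=1..n. v i * (if 1 < i then a (i - 1) else 0))
        = (\<Sum>i=Suc 1..<Suc n. v i * a (i - 1))"
      by (intro sum.mono_neutral_cong_right) auto
    moreover have "\<dots> = (\<Sum>i=1..<n. v (Suc i) * a i)"
      by (subst sum.shift_bounds_Suc_ivl) simp
    ultimately show ?thesis
      by (simp add: distrib_left sum.distrib gap_def left_diff_distrib sum_subtractf)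
  qed simp
  \<comment> \<open>The diagonal may be added because \<open>sgn 0 = 0\<close> makes
    \<open>K i i\<close> vanish; on the full square the summation indices can be exchanged.\<close>
  have diag: "(\<Sum>j\<in>{1..N} - {i}. f j * K i j) = (\<Sum>j=1..N. f j * K i j)" for f i
    by (rule sum.mono_neutral_left) (auto simp: K_def)
  have K_anti: "K j i = - K i j" for i j
    unfolding K_def by (cases i j rule: linorder_cases) (auto simp: abs_minus_commute)
  have *: "(\<Sum>i=1..N. \<Sum>j=1..N. v i * K i j) = (\<Sum>i=1..N. \<Sum>j=1..N. v j * K j i)"
    by (rule sum.swap)
  have anti: "(\<Sum>i=1..N. \<Sum>j=1..N. v j * K i j) = - (\<Sum>i=1..N. \<Sum>j=1..N. v i * K i j)"
  proof -
    have "v j * K i j = - (v j * K j i)" for i j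
      by (subst K_anti) simp
    then have "(\<Sum>i=1..N. \<Sum>j=1..N. v j * K i j) = - (\<Sum>i=1..N. \<Sum>j=1..N. v j * K j i)"
      unfolding sum_negf[symmetric] by (intro sum.cong refl)
    with * show ?thesis by simp
  qed
  have "(\<Sum>i=1..N. \<Sum>j\<in>{1..N} - {i}. sgn (real j - real i) * (v j - v i) * \<bar>Y j - Y i\<bar> powr (- m))
      = (\<Sum>i=1..N. \<Sum>j=1..N. (v j - v i) * K i j)"
    unfolding diag[symmetric] by (simp add: K_def mult_ac)
  also have "\<dots> = - 2 * (\<Sum>i=1..N. \<Sum>j=1..N. v i * K i j)"
    using anti by (simp add: left_diff_distrib sum_subtractf)
  also have "(\<Sum>i=1..N. \<Sum>j=1..N. v i * K i j)
      = (\<Sum>i=1..N. v i * (\<Sum>j\<in>{1..N} - {i}. K i j))"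
    using diag[where f = "\<lambda>j. 1"] by (simp add: sum_distrib_left)
  finally have nonloc: "(\<Sum>i=1..N. \<Sum>j\<in>{1..N} - {i}. sgn (real j - real i) * (v j - v i) * \<bar>Y j - Y i\<bar> powr (- m))
      = - 2 * (\<Sum>i=1..N. v i * (\<Sum>j\<in>{1..N} - {i}. K i j))" .
  have "(\<Sum>i=1..N. v i * rhs N m chi Y i)
      = (\<Sum>i=1..N. v i * ((if i < N then - a i else 0) + (if 1 < i then a (i - 1) else 0)))
        + 2 * chi * (\<Sum>i=1..N. v i * (\<Sum>j\<in>{1..N} - {i}. K i j))"
    unfolding rhs_def a_def[symmetric] K_def[symmetric]
    by (simp add: distrib_left sum.distrib sum_distrib_left mult_ac)
  then show ?thesis
    unfolding loc nonloc by (simp add: a_def)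
qed

text \<open>A constant \<open>v\<close> has no gaps and no differences: this is translation
  invariance. It keeps the centre of mass at 0 when local solutions are constructed.\<close>

lemma sum_rhs: "(\<Sum>i=1..N. rhs N m chi Y i) = 0"
  using rhs_pairing[of "\<lambda>_. 1" N m chi Y] by (simp add: gap_def)

lemma mult_powr_minus: "0 < x \<Longrightarrow> x * x powr (- m) = x powr (1 - m)" for x m :: real
  by (simp add: powr_diff powr_minus field_simps)

text \<open>The choice \<open>v = Y\<close> in the pairing gives Euler's identity for
  \<open>Fm\<close>, which is homogeneous of degree \<open>1 - m\<close>.\<close>

lemma rhs_Euler:
  assumes "Rset N Y" "m > 1"
  shows "(\<Sum>i=1..N. Y i * rhs N m chi Y i) = (m - 1) * Fm N m chi Y"
proof -
  have "(\<Sum>i=1..<N. gap Y i * gap Y i powr (- m)) = (\<Sum>i=1..<N. gap Y i powr (1 - m))"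
    using Rset_gap_pos[OF assms(1)] by (intro sum.cong refl mult_powr_minus)
  moreover have "(\<Sum>i=1..N. \<Sum>j\<in>{1..N} - {i}.
        sgn (real j - real i) * (Y j - Y i) * \<bar>Y j - Y i\<bar> powr (- m))
      = (\<Sum>i\<in>{1..N}. \<Sum>j\<in>{1..N} - {i}. \<bar>Y i - Y j\<bar> powr (1 - m))"
  proof (intro sum.cong refl)
    fix i j assume ij: "i \<in> {1..N}" "j \<in> {1..N} - {i}"
    then have "sgn (real j - real i) * (Y j - Y i) = \<bar>Y j - Y i\<bar>" "0 < \<bar>Y j - Y i\<bar>"
      using sgn_index_mult_diff[OF assms(1)] Rset_inj[OF assms(1), of j i] by auto
    then show "sgn (real j - real i) * (Y j - Y i) * \<bar>Y j - Y i\<bar> powr (- m)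
        = \<bar>Y i - Y j\<bar> powr (1 - m)"
      by (simp only: mult_powr_minus abs_minus_commute)
  qed
  ultimately show ?thesis
    unfolding rhs_pairing Fm_def using assms(2) by (simp add: right_diff_distrib)
qed

text \<open>Differentiating term by term produces the expression of \<open>rhs_pairing\<close> with
  \<open>v = d\<close>, so \<open>rhs\<close> is minus the gradient of \<open>Fm\<close>. Along the
  flow, where \<open>d\<close> is \<open>rhs\<close> itself, this is the energy dissipation
  identity.\<close>

lemma Fm_has_derivative_along:
  assumes "Rset N (Z t)" "m > 1"
    and der: "\<And>i. i \<in> {1..N} \<Longrightarrow> ((\<lambda>s. Z s i) has_real_derivative d i) (at t within S)"
  shows "((\<lambda>s. Fm N m chi (Z s)) has_real_derivative - (\<Sum>i=1..N. d i * rhs N m chi (Z t) i))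
           (at t within S)"
proof -
  have loc: "((\<lambda>s. \<Sum>i=1..<N. gap (Z s) i powr (1 - m)) has_real_derivative
      (\<Sum>i=1..<N. (1 - m) * (gap d i * gap (Z t) i powr (- m)))) (at t within S)"
  proof (intro DERIV_sum)
    fix i assume i: "i \<in> {1..<N}"
    have "((\<lambda>s. gap (Z s) i) has_real_derivative gap d i) (at t within S)"
      using der[of i] der[of "Suc i"] i unfolding gap_def by (auto intro!: derivative_eq_intros)
    from has_real_derivative_powr[THEN DERIV_chain2, OF _ this, of "1 - m"]
    show "((\<lambda>s. gap (Z s) i powr (1 - m)) has_real_derivative
        (1 - m) * (gap d i * gap (Z t) i powr (- m))) (at t within S)"
      using Rset_gap_pos[OF assms(1) i] by (simp add: mult_ac)
  qed
  have nonloc: "((\<lambda>s. \<Sum>i\<in>{1..N}. \<Sum>j\<in>{1..N} - {i}. \<bar>Z s i - Z s j\<bar> powr (1 - m)) has_real_derivative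
      (\<Sum>i\<in>{1..N}. \<Sum>j\<in>{1..N} - {i}.
         (1 - m) * (sgn (real j - real i) * (d j - d i) * \<bar>Z t j - Z t i\<bar> powr (- m))))
      (at t within S)"
  proof (intro DERIV_sum)
    fix i j assume ij: "i \<in> {1..N}" "j \<in> {1..N} - {i}"
    \<comment> \<open>Writing a power of |x| as a power of \<open>x\<^sup>2\<close> avoids
      differentiating the absolute value.\<close>
    have sq: "(x\<^sup>2) powr a = \<bar>x\<bar> powr (2 * a)" for x a :: real
    proof -
      have "x\<^sup>2 = \<bar>x\<bar> powr 2" by simp
      then show ?thesis by (simp only: powr_powr)
    qed
    have "2 * ((1 - m) / 2) = 1 - m" by (simp add: field_simps)
    then have sq1: "\<bar>x\<bar> powr (1 - m) = (x\<^sup>2) powr ((1 - m) / 2)" for x :: real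
      by (simp only: sq)
    define x where "x = Z t j - Z t i"
    have x: "x \<noteq> 0" "x = sgn (real j - real i) * \<bar>x\<bar>"
      using Rset_inj[OF assms(1), of j i] sgn_index_mult_diff[OF assms(1), of i j] ij
      by (auto simp: x_def sgn_if split: if_splits)
    have "((\<lambda>s. (Z s i - Z s j)\<^sup>2) has_real_derivative 2 * x * (d j - d i)) (at t within S)"
      using der[of i] der[of j] ij unfolding x_def by (auto intro!: derivative_eq_intros simp: algebra_simps)
    from has_real_derivative_powr[THEN DERIV_chain2, OF _ this, of "(1 - m) / 2"]
    have D: "((\<lambda>s. \<bar>Z s i - Z s j\<bar> powr (1 - m)) has_real_derivative
        (1 - m) / 2 * (x\<^sup>2) powr ((1 - m) / 2 - 1) * (2 * x * (d j - d i))) (at t within S)"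
      unfolding sq1 using x(1) by (simp add: x_def power2_commute)
    have "(x\<^sup>2) powr ((1 - m) / 2 - 1) = \<bar>x\<bar> powr (- m - 1)"
    proof -
      have "2 * ((1 - m) / 2 - 1) = - m - 1" by (simp add: field_simps)
      then show ?thesis by (simp only: sq)
    qed
    also have "\<dots> = \<bar>x\<bar> powr (- m) / \<bar>x\<bar>"
      using x(1) by (simp add: powr_diff)
    finally have "(x\<^sup>2) powr ((1 - m) / 2 - 1) * x
        = \<bar>x\<bar> powr (- m) / \<bar>x\<bar> * (sgn (real j - real i) * \<bar>x\<bar>)"
      using x(2) by metis
    then have "(x\<^sup>2) powr ((1 - m) / 2 - 1) * x = sgn (real j - real i) * \<bar>x\<bar> powr (- m)"
      using x(1) by simp
    then have eq: "(1 - m) / 2 * (x\<^sup>2) powr ((1 - m) / 2 - 1) * (2 * x * (d j - d i))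
        = (1 - m) * (sgn (real j - real i) * (d j - d i) * \<bar>x\<bar> powr (- m))"
    proof -
      assume *: "(x\<^sup>2) powr ((1 - m) / 2 - 1) * x = sgn (real j - real i) * \<bar>x\<bar> powr (- m)"
      have "(1 - m) / 2 * (x\<^sup>2) powr ((1 - m) / 2 - 1) * (2 * x * (d j - d i))
          = (1 - m) * ((x\<^sup>2) powr ((1 - m) / 2 - 1) * x) * (d j - d i)"
        by simp
      then show ?thesis
        unfolding * by (simp only: mult_ac)
    qed
    from D[unfolded eq] show "((\<lambda>s. \<bar>Z s i - Z s j\<bar> powr (1 - m)) has_real_derivative
        (1 - m) * (sgn (real j - real i) * (d j - d i) * \<bar>Z t j - Z t i\<bar> powr (- m)))
        (at t within S)"
      unfolding x_def .
  qed
  have "((\<lambda>s. Fm N m chi (Z s)) has_real_derivative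
      1 / (m - 1) * (\<Sum>i=1..<N. (1 - m) * (gap d i * gap (Z t) i powr (- m)))
      - chi / (m - 1) * (\<Sum>i\<in>{1..N}. \<Sum>j\<in>{1..N} - {i}.
         (1 - m) * (sgn (real j - real i) * (d j - d i) * \<bar>Z t j - Z t i\<bar> powr (- m))))
      (at t within S)"
    unfolding Fm_def by (intro derivative_intros DERIV_cmult loc nonloc)
  moreover have "1 / (m - 1) * (\<Sum>i=1..<N. (1 - m) * (gap d i * gap (Z t) i powr (- m)))
      - chi / (m - 1) * (\<Sum>i\<in>{1..N}. \<Sum>j\<in>{1..N} - {i}.
         (1 - m) * (sgn (real j - real i) * (d j - d i) * \<bar>Z t j - Z t i\<bar> powr (- m)))
      = - (\<Sum>i=1..N. d i * rhs N m chi (Z t) i)"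
  proof -
    have "1 / k * (- k * a) - chi / k * (- k * b) = - (a - chi * b)" if "k \<noteq> 0" for a b k
      using that by simp
    from this[of "m - 1"]
    have "1 / (m - 1) * ((1 - m) * a) - chi / (m - 1) * ((1 - m) * b) = - (a - chi * b)" for a b
      using assms(2) by simp
    then show ?thesis
      unfolding rhs_pairing sum_distrib_left[symmetric] .
  qed
  ultimately show ?thesis by simp
qed

section \<open>Convexity of negative powers\<close>

text \<open>The line on the left is the tangent at 1. Since \<open>a < 0\<close>, the bound
  \<open>ln s \<le> s - 1\<close> is reversed on multiplication by \<open>a\<close>, and exp z is at
  least 1 + z.\<close>

lemma powr_ge_tangent:
  fixes s a :: real
  assumes "0 < s" "a < 0"
  shows "1 + a * (s - 1) \<le> s powr a"
proof -
  have "a * (s - 1) \<le> a * ln s"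
    using assms ln_le_minus_one[of s] by (intro mult_left_mono_neg) auto
  also have "1 + a * ln s \<le> exp (a * ln s)"
    by (rule exp_ge_add_one_self)
  finally show ?thesis
    using assms by (simp add: powr_def)
qed

text \<open>This is Jensen's inequality for the convex function z^(1-m) at the points
  \<open>x k / y k\<close> with weights \<open>y k / sum y A\<close>, multiplied by
  \<open>sum y A powr (1 - m)\<close>.\<close>

lemma powr_sum_Jensen:
  fixes x y :: "'a \<Rightarrow> real"
  assumes "finite A" "A \<noteq> {}" "m > 1"
    and x: "\<And>k. k \<in> A \<Longrightarrow> 0 < x k" and y: "\<And>k. k \<in> A \<Longrightarrow> 0 < y k"
  shows "sum x A powr (1 - m) \<le> (\<Sum>k\<in>A. x k powr (1 - m) * y k powr m) * sum y A powr (- m)"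
proof -
  define u where "u = sum x A"
  define w where "w = sum y A"
  have pos: "0 < u" "0 < w"
    unfolding u_def w_def using assms by (auto intro: sum_pos)
  \<comment> \<open>Each summand on the left is \<open>y k\<close> times the tangent line of z^(1-m)
    at the mean ratio \<open>u / w\<close>, evaluated at \<open>x k / y k\<close>.\<close>
  have "(\<Sum>k\<in>A. (u / w) powr (1 - m) * (y k + (1 - m) * (w / u * x k - y k)))
      \<le> (\<Sum>k\<in>A. x k powr (1 - m) * y k powr m)"
  proof (rule sum_mono)
    fix k assume k: "k \<in> A"
    have "y k + (1 - m) * (w / u * x k - y k) = y k * (1 + (1 - m) * (w * x k / (u * y k) - 1))"
      using y[OF k] pos by (simp add: field_simps)
    also have "\<dots> \<le> y k * (w * x k / (u * y k)) powr (1 - m)"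
      using x[OF k] y[OF k] pos assms(3) by (intro mult_left_mono powr_ge_tangent) auto
    finally have "(u / w) powr (1 - m) * (y k + (1 - m) * (w / u * x k - y k))
        \<le> (u / w) powr (1 - m) * (y k * (w * x k / (u * y k)) powr (1 - m))"
      by (rule mult_left_mono) simp
    also have "\<dots> = x k powr (1 - m) * y k powr m"
      using x[OF k] y[OF k] pos
      by (simp add: powr_mult powr_divide powr_diff powr_minus field_simps)
    finally show "(u / w) powr (1 - m) * (y k + (1 - m) * (w / u * x k - y k))
        \<le> x k powr (1 - m) * y k powr m" .
  qed
  \<comment> \<open>The first-order terms cancel, as \<open>u / w\<close> is the weighted mean of
    the ratios.\<close>
  also have "(\<Sum>k\<in>A. (u / w) powr (1 - m) * (y k + (1 - m) * (w / u * x k - y k)))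
      = (u / w) powr (1 - m) * w"
  proof -
    have "(\<Sum>k\<in>A. w / u * x k) = w"
      using pos unfolding sum_distrib_left[symmetric] u_def[symmetric] by simp
    then show ?thesis
      unfolding sum_distrib_left[symmetric] sum.distrib sum_subtractf w_def[symmetric] by simp
  qed
  finally have "(u / w) powr (1 - m) * w * w powr (- m)
      \<le> (\<Sum>k\<in>A. x k powr (1 - m) * y k powr m) * w powr (- m)"
    by (rule mult_right_mono) simp
  moreover have "(u / w) powr (1 - m) * w * w powr (- m) = u powr (1 - m)"
    using pos by (simp add: powr_divide mult_powr_minus mult.assoc)
  ultimately show ?thesis
    by (simp add: u_def w_def)
qed

section \<open>Absence of global solutions\<close>

text \<open>Once the supremum \<open>S\<close> of the ratios is known to be finite and positive,
  \<open>1 / chi < S\<close>, so some configuration has a ratio above \<open>1 / chi\<close>, which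
  means negative energy. \<open>X0\<close> makes the set of ratios nonempty and its supremum
  positive.\<close>

lemma exists_negative_energy:
  assumes "m > 1" "N \<ge> 2" "chi > Cconst N m" "Rset N X0"
  shows "0 < chi" and "\<exists>X. Rset N X \<and> Fm N m chi X < 0"
proof -
  define A where "A X = (\<Sum>i=1..<N. gap X i powr (1 - m))" for X
  define B where "B X = (\<Sum>i\<in>{1..N}. \<Sum>j\<in>{1..N} - {i}. \<bar>X j - X i\<bar> powr (1 - m))" for X
  define S where "S = Sup (ratio N m ` {X. Rset N X})"
  have ratio: "ratio N m X = B X / A X" for X
    by (simp add: ratio_def A_def B_def)
  have A_pos: "0 < A X" if "Rset N X" for X
    unfolding A_def using assms(2) Rset_gap_pos[OF that]
    by (intro sum_pos) (auto simp: less_imp_neq[THEN not_sym])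
  \<comment> \<open>A distance is at least the gap at its left end, and the exponent is
    negative.\<close>
  have term_le: "\<bar>X j - X i\<bar> powr (1 - m) \<le> A X"
    if X: "Rset N X" and ij: "i \<in> {1..N}" "j \<in> {1..N}" "i < j" for X i j
  proof -
    have "gap X i \<le> X j - X i"
      using Rset_strict_mono[OF X, of "Suc i" j] ij
      by (cases "j = Suc i") (auto simp: gap_def less_eq_real_def)
    then have "\<bar>X j - X i\<bar> powr (1 - m) \<le> gap X i powr (1 - m)"
      using Rset_gap_pos[OF X, of i] ij assms(1) by (intro powr_mono2') auto
    also have "\<dots> \<le> A X"
      unfolding A_def using ij by (intro member_le_sum) auto
    finally show ?thesis .
  qed
  \<comment> \<open>A crude bound is enough: it makes \<open>Sup\<close> a genuine least upper
    bound.\<close>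
  have "ratio N m X \<le> real N * real N" if X: "Rset N X" for X
  proof -
    have "B X \<le> (\<Sum>i\<in>{1..N}. \<Sum>j\<in>{1..N} - {i}. A X)"
      unfolding B_def
    proof (intro sum_mono)
      fix i j assume "i \<in> {1..N}" "j \<in> {1..N} - {i}"
      then show "\<bar>X j - X i\<bar> powr (1 - m) \<le> A X"
        using term_le[OF X, of i j] term_le[OF X, of j i]
        by (cases i j rule: linorder_cases) (auto simp: abs_minus_commute)
    qed
    also have "\<dots> \<le> (\<Sum>i\<in>{1..N}. \<Sum>j\<in>{1..N}. A X)"
      using A_pos[OF X] by (intro sum_mono sum_mono2) auto
    finally show ?thesis
      unfolding ratio using A_pos[OF X] by (simp add: pos_divide_le_eq)
  qed
  then have bdd: "bdd_above (ratio N m ` {X. Rset N X})"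
    by (auto intro!: bdd_aboveI)
  have "0 < \<bar>X0 2 - X0 1\<bar> powr (1 - m)"
    using Rset_inj[OF assms(4), of 2 1] assms(2) by auto
  also have "\<dots> \<le> (\<Sum>j\<in>{1..N} - {1}. \<bar>X0 j - X0 1\<bar> powr (1 - m))"
    using assms(2) by (intro member_le_sum) auto
  also have "\<dots> \<le> B X0"
    unfolding B_def using assms(2)
    by (intro member_le_sum[where f = "\<lambda>i. \<Sum>j\<in>{1..N} - {i}. \<bar>X0 j - X0 i\<bar> powr (1 - m)"])
      (auto intro: sum_nonneg)
  finally have "0 < ratio N m X0"
    unfolding ratio using A_pos[OF assms(4)] by simp
  also have "\<dots> \<le> S"
    unfolding S_def using bdd assms(4) by (intro cSup_upper) auto
  finally have S: "0 < S" .
  have chi: "1 / S < chi"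
    using assms(3) by (simp add: Cconst_def S_def)
  then show "0 < chi"
    using S by (meson less_trans zero_less_divide_1_iff)
  then have "1 / chi < S"
    using S chi by (simp add: field_simps)
  then obtain X where X: "Rset N X" "1 / chi < ratio N m X"
    unfolding S_def using assms(4) by (subst (asm) less_cSup_iff[OF _ bdd]) auto
  then have "A X < chi * B X"
    using A_pos[OF X(1)] \<open>0 < chi\<close> unfolding ratio by (simp add: field_simps)
  moreover have "Fm N m chi X = (A X - chi * B X) / (m - 1)"
    by (simp add: Fm_def A_def B_def abs_minus_commute diff_divide_distrib)
  ultimately show "\<exists>X. Rset N X \<and> Fm N m chi X < 0"
    using X(1) assms(1) by (auto simp: divide_less_0_iff)
qed

section \<open>Lower bound for the gradient on spheres\<close>

text \<open>The gaps of \<open>v\<close> are chosen so that the local terms of the pairing become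
  exactly those of \<open>X\<close>. Jensen over the gaps between \<open>i\<close> and
  \<open>j\<close> bounds each interaction term from below by that of \<open>X\<close>, and
  \<open>chi \<ge> 0\<close> gives this the right sign. Starting the sums at 1 normalises
  \<open>v\<close> to be nonnegative.\<close>

lemma rhs_pairing_Jensen:
  assumes "m > 1" "chi \<ge> 0" and X: "Rset N X" and Y: "Rset N Y"
  defines "v \<equiv> \<lambda>k. \<Sum>i\<in>{1..<k}. gap X i powr (1 - m) * gap Y i powr m"
  shows "(\<Sum>i=1..N. v i * rhs N m chi Y i) \<le> (m - 1) * Fm N m chi X"
proof -
  define w where "w i = gap X i powr (1 - m) * gap Y i powr m" for i
  have v_diff: "v j - v i = sum w {i..<j}" if "1 \<le> i" "i \<le> j" for i j
    unfolding v_def w_def[symmetric] using sum.atLeastLessThan_concat[OF that, of w] by simp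
  have "gap v i * gap Y i powr (- m) = gap X i powr (1 - m)" if "i \<in> {1..<N}" for i
  proof -
    have "gap v i = w i"
      using v_diff[of i "Suc i"] that by (simp add: gap_def)
    then show ?thesis
      using Rset_gap_pos[OF Y that] by (simp add: w_def powr_minus)
  qed
  then have loc: "(\<Sum>i=1..<N. gap v i * gap Y i powr (- m)) = (\<Sum>i=1..<N. gap X i powr (1 - m))"
    by (intro sum.cong refl)
  have le: "\<bar>X j - X i\<bar> powr (1 - m) \<le> (v j - v i) * \<bar>Y j - Y i\<bar> powr (- m)"
    if ij: "i \<in> {1..N}" "j \<in> {1..N}" "i < j" for i j
  proof -
    have "sum (gap X) {i..<j} powr (1 - m) \<le> sum w {i..<j} * sum (gap Y) {i..<j} powr (- m)"
      unfolding w_def using ij assms(1) Rset_gap_pos[OF X] Rset_gap_pos[OF Y]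
      by (intro powr_sum_Jensen) auto
    moreover have "sum (gap X) {i..<j} = \<bar>X j - X i\<bar>" "sum (gap Y) {i..<j} = \<bar>Y j - Y i\<bar>"
      using sum_gap[of i j X] sum_gap[of i j Y] ij
        Rset_strict_mono[OF X, of i j] Rset_strict_mono[OF Y, of i j] by auto
    ultimately show ?thesis
      using v_diff[of i j] ij by simp
  qed
  have "(\<Sum>i\<in>{1..N}. \<Sum>j\<in>{1..N} - {i}. \<bar>X i - X j\<bar> powr (1 - m))
      \<le> (\<Sum>i\<in>{1..N}. \<Sum>j\<in>{1..N} - {i}.
           sgn (real j - real i) * (v j - v i) * \<bar>Y j - Y i\<bar> powr (- m))"
  proof (intro sum_mono)
    fix i j assume "i \<in> {1..N}" "j \<in> {1..N} - {i}"
    then show "\<bar>X i - X j\<bar> powr (1 - m)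
        \<le> sgn (real j - real i) * (v j - v i) * \<bar>Y j - Y i\<bar> powr (- m)"
      using le[of i j] le[of j i]
      by (cases i j rule: linorder_cases) (auto simp: abs_minus_commute)
  qed
  then have "(\<Sum>i=1..N. v i * rhs N m chi Y i) \<le> (\<Sum>i=1..<N. gap X i powr (1 - m))
      - chi * (\<Sum>i\<in>{1..N}. \<Sum>j\<in>{1..N} - {i}. \<bar>X i - X j\<bar> powr (1 - m))"
    unfolding rhs_pairing loc using assms(2) by (simp add: mult_left_mono)
  also have "\<dots> = (m - 1) * Fm N m chi X"
    using assms(1) by (simp add: Fm_def right_diff_distrib)
  finally show ?thesis .
qed

text \<open>Two vectors increasing in the index satisfy Chebyshev's sum inequality: every product
  \<open>(v i - v j) * (Y i - Y j)\<close> is nonnegative, and since \<open>Y\<close> has sum 0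
  their double sum is 2N times the pairing.\<close>

lemma Rset_Chebyshev:
  assumes "Rset N Y" and mono: "\<And>i j. 1 \<le> i \<Longrightarrow> i \<le> j \<Longrightarrow> j \<le> N \<Longrightarrow> v i \<le> v j"
  shows "0 \<le> (\<Sum>i=1..N. v i * Y i)"
proof -
  have Y0: "(\<Sum>i=1..N. Y i) = 0"
    using assms(1) by (simp add: Rset_def)
  have "0 \<le> (v i - v j) * (Y i - Y j)" if "i \<in> {1..N}" "j \<in> {1..N}" for i j
    using Rset_strict_mono[OF assms(1), of i j] Rset_strict_mono[OF assms(1), of j i]
      mono[of i j] mono[of j i] that
    by (cases i j rule: linorder_cases) (auto simp: mult_nonpos_nonpos)
  then have "0 \<le> (\<Sum>i=1..N. \<Sum>j=1..N. (v i - v j) * (Y i - Y j))"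
    by (intro sum_nonneg)
  also have "\<dots> = 2 * real N * (\<Sum>i=1..N. v i * Y i)"
  proof -
    have "(\<Sum>i=1..N. \<Sum>j=1..N. (v i - v j) * (Y i - Y j))
        = (\<Sum>i=1..N. real N * (v i * Y i) + (\<Sum>j=1..N. v j * Y j)
            - v i * (\<Sum>j=1..N. Y j) - Y i * (\<Sum>j=1..N. v j))"
      by (simp add: algebra_simps sum.distrib sum_subtractf sum_distrib_left)
    also have "\<dots> = 2 * real N * (\<Sum>i=1..N. v i * Y i)"
      by (simp add: Y0[simplified] sum.distrib sum_subtractf flip: sum_distrib_left sum_distrib_right)
    finally show ?thesis .
  qed
  finally show ?thesis
    by (cases "N = 0") (auto simp: zero_le_mult_iff)
qed

lemma abs_component_le_sqrt_sum:
  fixes Y :: "nat \<Rightarrow> real"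
  assumes "i \<in> {1..N}"
  shows "\<bar>Y i\<bar> \<le> sqrt (\<Sum>i=1..N. (Y i)\<^sup>2)"
  using assms member_le_sum[of i "{1..N}" "\<lambda>i. (Y i)\<^sup>2"] by (intro real_le_rsqrt) auto

text \<open>The right-hand side is the squared norm of the part of \<open>rhs\<close> orthogonal to
  \<open>Y\<close>. The vector \<open>v\<close> of \<open>rhs_pairing_Jensen\<close> pairs with this
  part to at most \<open>- c\<close>, so Cauchy-Schwarz and an upper bound for |v| give the
  estimate.\<close>

lemma spherical_gradient_lower_bound:
  assumes "m > 1" "N \<ge> 2" "chi \<ge> 0" and X: "Rset N X" "Fm N m chi X < 0"
  obtains \<kappa> where "0 < \<kappa>"
    "\<And>Y. Rset N Y \<Longrightarrow> 0 \<le> Fm N m chi Y \<Longrightarrow>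
       \<kappa> * (\<Sum>i=1..N. (Y i)\<^sup>2) powr (- m)
         \<le> (\<Sum>i=1..N. (rhs N m chi Y i)\<^sup>2) - ((m - 1) * Fm N m chi Y)\<^sup>2 / (\<Sum>i=1..N. (Y i)\<^sup>2)"
proof -
  define c where "c = - ((m - 1) * Fm N m chi X)"
  define D where "D = (\<Sum>i=1..<N. gap X i powr (1 - m))"
  \<comment> \<open>This is \<open>c\<^sup>2\<close> divided by the bound for |v|^2 with the factor
    \<open>Q powr m\<close> removed. That bound comes from gaps of \<open>Y\<close> being at most
    \<open>2 * sqrt Q\<close>.\<close>
  define \<kappa> where "\<kappa> = c\<^sup>2 / (real N * D\<^sup>2 * 4 powr m)"
  have c: "0 < c"
    using assms by (simp add: c_def mult_pos_neg)
  have D: "0 < D"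
    unfolding D_def using assms(2) Rset_gap_pos[OF X(1)]
    by (intro sum_pos) (auto simp: less_imp_neq[THEN not_sym])
  have \<kappa>: "0 < \<kappa>"
    unfolding \<kappa>_def using c D assms(2) by simp
  have "\<kappa> * (\<Sum>i=1..N. (Y i)\<^sup>2) powr (- m)
      \<le> (\<Sum>i=1..N. (rhs N m chi Y i)\<^sup>2) - ((m - 1) * Fm N m chi Y)\<^sup>2 / (\<Sum>i=1..N. (Y i)\<^sup>2)"
    if Y: "Rset N Y" and F: "0 \<le> Fm N m chi Y" for Y
  proof -
    define Q where "Q = (\<Sum>i=1..N. (Y i)\<^sup>2)"
    define r where "r = rhs N m chi Y"
    define E where "E = (m - 1) * Fm N m chi Y"
    define v where "v k = (\<Sum>i\<in>{1..<k}. gap X i powr (1 - m) * gap Y i powr m)" for k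
    have Q: "0 < Q"
      unfolding Q_def by (rule Rset_sum_squares_pos[OF Y assms(2)])
    have E: "0 \<le> E"
      using F assms(1) by (simp add: E_def)
    have v_mono: "v i \<le> v j" if "i \<le> j" for i j
      unfolding v_def using that by (intro sum_mono2) auto
    have gap_le: "gap Y i \<le> 2 * sqrt Q" if "i \<in> {1..<N}" for i
      using abs_component_le_sqrt_sum[of i N Y] abs_component_le_sqrt_sum[of "Suc i" N Y] that
      by (simp add: gap_def Q_def)
    have "0 \<le> v k" "v k \<le> D * (2 * sqrt Q) powr m" if "k \<in> {1..N}" for k
    proof -
      show "0 \<le> v k"
        unfolding v_def by (intro sum_nonneg) auto
      have "v k \<le> v N"
        using that by (intro v_mono) simp
      also have "\<dots> \<le> (\<Sum>i\<in>{1..<N}. gap X i powr (1 - m) * (2 * sqrt Q) powr m)"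
        unfolding v_def using gap_le Rset_gap_pos[OF Y] assms(1)
        by (intro sum_mono mult_left_mono powr_mono2) (auto simp: less_imp_le)
      finally show "v k \<le> D * (2 * sqrt Q) powr m"
        by (simp add: D_def sum_distrib_right)
    qed
    then have "(\<Sum>k=1..N. (v k)\<^sup>2) \<le> (\<Sum>k=1..N. (D * (2 * sqrt Q) powr m)\<^sup>2)"
      by (intro sum_mono power_mono) auto
    also have "\<dots> = real N * D\<^sup>2 * (4 * Q) powr m"
    proof -
      have "((2 * sqrt Q) powr m)\<^sup>2 = ((2 * sqrt Q) * (2 * sqrt Q)) powr m"
        using Q by (simp add: power2_eq_square flip: powr_mult)
      also have "(2 * sqrt Q) * (2 * sqrt Q) = 4 * Q"
        using Q by simp
      finally show ?thesis
        by (simp add: power_mult_distrib)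
    qed
    finally have v2: "(\<Sum>k=1..N. (v k)\<^sup>2) \<le> real N * D\<^sup>2 * (4 * Q) powr m" .
    \<comment> \<open>Removing the radial part only lowers the pairing: \<open>E\<close> is
      nonnegative, and so is the pairing of \<open>v\<close> with \<open>Y\<close> by
      Chebyshev.\<close>
    have pair: "(\<Sum>i=1..N. v i * (r i - E / Q * Y i)) \<le> - c"
    proof -
      have "(\<Sum>i=1..N. v i * (r i - E / Q * Y i))
          = (\<Sum>i=1..N. v i * r i) - E / Q * (\<Sum>i=1..N. v i * Y i)"
        by (simp add: right_diff_distrib sum_subtractf sum_distrib_left mult_ac)
      moreover have "0 \<le> E / Q * (\<Sum>i=1..N. v i * Y i)"
        using E Q Rset_Chebyshev[OF Y, of v] v_mono by (intro mult_nonneg_nonneg) auto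
      moreover have "(\<Sum>i=1..N. v i * r i) \<le> - c"
        using rhs_pairing_Jensen[OF assms(1,3) X(1) Y] by (simp add: v_def r_def c_def)
      ultimately show ?thesis by simp
    qed
    have "c\<^sup>2 \<le> (\<Sum>i=1..N. v i * (r i - E / Q * Y i))\<^sup>2"
      using pair c power_mono[of c "- (\<Sum>i=1..N. v i * (r i - E / Q * Y i))" 2] by simp
    also have "\<dots> \<le> (\<Sum>i=1..N. (v i)\<^sup>2) * (\<Sum>i=1..N. (r i - E / Q * Y i)\<^sup>2)"
      by (rule Cauchy_Schwarz_ineq_sum)
    \<comment> \<open>By Euler's identity \<open>E / Q * Y\<close> is the orthogonal projection of
      \<open>r\<close> on \<open>Y\<close>, so this is Pythagoras.\<close>
    also have "(\<Sum>i=1..N. (r i - E / Q * Y i)\<^sup>2) = (\<Sum>i=1..N. (r i)\<^sup>2) - E\<^sup>2 / Q"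
    proof -
      have expand: "(\<Sum>i=1..N. (r i - l * Y i)\<^sup>2)
          = (\<Sum>i=1..N. (r i)\<^sup>2) + l\<^sup>2 * Q - 2 * l * (\<Sum>i=1..N. Y i * r i)" for l
        unfolding Q_def
        by (simp add: power2_diff sum.distrib sum_subtractf sum_distrib_left power_mult_distrib mult_ac)
      have "(\<Sum>i=1..N. Y i * r i) = E"
        unfolding r_def E_def by (rule rhs_Euler[OF Y assms(1)])
      then show ?thesis
        unfolding expand using Q by (simp add: power2_eq_square field_simps)
    qed
    finally have cs: "c\<^sup>2 \<le> (\<Sum>i=1..N. (v i)\<^sup>2) * ((\<Sum>i=1..N. (r i)\<^sup>2) - E\<^sup>2 / Q)" .
    \<comment> \<open>The sign is needed to replace |v|^2 by its upper bound; a negative factor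
      would contradict \<open>cs\<close>, whose left side is positive.\<close>
    have nn: "0 \<le> (\<Sum>i=1..N. (r i)\<^sup>2) - E\<^sup>2 / Q"
    proof (rule ccontr)
      assume "\<not> ?thesis"
      then have "(\<Sum>i=1..N. (v i)\<^sup>2) * ((\<Sum>i=1..N. (r i)\<^sup>2) - E\<^sup>2 / Q) \<le> 0"
        by (intro mult_nonneg_nonpos sum_nonneg) auto
      moreover have "0 < c\<^sup>2" using c by simp
      ultimately show False using cs by linarith
    qed
    have "c\<^sup>2 \<le> real N * D\<^sup>2 * (4 * Q) powr m * ((\<Sum>i=1..N. (r i)\<^sup>2) - E\<^sup>2 / Q)"
      using cs mult_right_mono[OF v2 nn] by linarith
    moreover have "0 < real N * D\<^sup>2 * (4 * Q) powr m"
      using D Q assms(2) by simp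
    ultimately have "c\<^sup>2 / (real N * D\<^sup>2 * (4 * Q) powr m) \<le> (\<Sum>i=1..N. (r i)\<^sup>2) - E\<^sup>2 / Q"
      by (simp add: pos_divide_le_eq mult.commute)
    moreover have "c\<^sup>2 / (real N * D\<^sup>2 * (4 * Q) powr m) = \<kappa> * Q powr (- m)"
      using Q by (simp add: \<kappa>_def powr_mult powr_minus field_simps)
    ultimately show ?thesis
      by (simp add: Q_def r_def E_def)
  qed
  with \<kappa> show ?thesis by (rule that)
qed

section \<open>Contradiction from integrating in time\<close>

text \<open>\<open>G\<close> decreases, so \<open>W\<close> grows at most linearly. Then
  \<open>G\<close> loses at least a fixed multiple of a logarithm, which is unbounded, and must
  become negative. The argument starts at time 1, inside the open half-line.\<close>

lemma no_eternal_solution_of_differential_inequalities: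
  fixes G W :: "real \<Rightarrow> real"
  assumes "0 < \<kappa>" "0 \<le> c"
    and nonneg: "\<And>t. 0 < t \<Longrightarrow> 0 \<le> G t" and pos: "\<And>t. 0 < t \<Longrightarrow> 0 < W t"
    and dG: "\<And>t. 0 < t \<Longrightarrow> \<exists>g. (G has_real_derivative g) (at t) \<and> g \<le> - \<kappa> / W t"
    and dW: "\<And>t. 0 < t \<Longrightarrow> (W has_real_derivative c * G t) (at t)"
  shows False
proof -
  have G_le: "G t \<le> G 1" if "1 \<le> t" for t
  proof (rule DERIV_nonpos_imp_nonincreasing[OF that])
    fix x :: real assume "1 \<le> x" "x \<le> t"
    then show "\<exists>y. DERIV G x :> y \<and> y \<le> 0"
      using dG[of x] pos[of x] assms(1)
      by (smt (verit) divide_nonpos_pos)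
  qed
  \<comment> \<open>The summand 1 makes the slope positive, so that one may divide by
    \<open>b\<close>.\<close>
  define b where "b = c * G 1 + 1"
  have b: "0 < b"
    using assms(2) nonneg[of 1] by (simp add: b_def add_nonneg_pos)
  define L where "L t = W 1 + b * (t - 1)" for t
  have L_pos: "0 < L t" if "1 \<le> t" for t
    using pos[of 1] b that by (simp add: L_def add_pos_nonneg)
  have W_le: "W t \<le> L t" if "1 \<le> t" for t
  proof -
    have "W t - L t \<le> W 1 - L 1"
    proof (rule DERIV_nonpos_imp_nonincreasing[OF that])
      fix x :: real assume x: "1 \<le> x" "x \<le> t"
      have "((\<lambda>x. W x - L x) has_real_derivative c * G x - b) (at x)"
        unfolding L_def using dW[of x] x by (auto intro!: derivative_eq_intros)
      moreover have "c * G x - b \<le> 0"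
        using mult_left_mono[OF G_le[of x] assms(2)] x by (simp add: b_def)
      ultimately show "\<exists>y. DERIV (\<lambda>x. W x - L x) x :> y \<and> y \<le> 0" by blast
    qed
    then show ?thesis by (simp add: L_def)
  qed
  have H: "G t + \<kappa> / b * ln (L t) \<le> G 1 + \<kappa> / b * ln (L 1)" if "1 \<le> t" for t
  proof (rule DERIV_nonpos_imp_nonincreasing[OF that])
    fix x :: real assume x: "1 \<le> x" "x \<le> t"
    obtain g where g: "DERIV G x :> g" "g \<le> - \<kappa> / W x"
      using dG[of x] x by auto
    have "((\<lambda>x. G x + \<kappa> / b * ln (L x)) has_real_derivative g + \<kappa> / L x) (at x)"
      using g(1) L_pos[OF x(1)] b unfolding L_def
      by (auto intro!: derivative_eq_intros)
    moreover have "\<kappa> / L x \<le> \<kappa> / W x"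
      using W_le[OF x(1)] pos[of x] x assms(1) by (intro divide_left_mono) auto
    ultimately show "\<exists>y. DERIV (\<lambda>x. G x + \<kappa> / b * ln (L x)) x :> y \<and> y \<le> 0"
      using g(2) by (intro exI[of _ "g + \<kappa> / L x"]) auto
  qed
  \<comment> \<open>\<open>s\<close> is the value of \<open>ln (L t)\<close> at which the bound
    \<open>H\<close> forces \<open>G t \<le> - 1\<close>; the next \<open>t\<close> makes
    \<open>L t\<close> at least \<open>exp s\<close>.\<close>
  define s where "s = b / \<kappa> * (G 1 + 1) + ln (L 1)"
  define t where "t = 1 + exp s / b"
  have t: "1 \<le> t"
    using b by (simp add: t_def)
  have "exp s \<le> L t"
    using b pos[of 1] by (simp add: L_def t_def)
  then have "s \<le> ln (L t)"
    using L_pos[OF t] by (metis ln_ge_iff)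
  then have "\<kappa> / b * s \<le> \<kappa> / b * ln (L t)"
    using assms(1) b by (intro mult_left_mono) auto
  moreover have "\<kappa> / b * s = G 1 + 1 + \<kappa> / b * ln (L 1)"
    using assms(1) b by (simp add: s_def field_simps)
  ultimately have "G t \<le> - 1"
    using H[OF t] by linarith
  then show False
    using nonneg[of t] t by simp
qed

text \<open>Euler's identity and energy dissipation give the derivatives of \<open>Q\<close> and
  \<open>F\<close>; the spherical bound turns them into the differential inequalities excluded
  above. Restricting to \<open>t > 0\<close> makes the one-sided derivatives two-sided.\<close>

lemma no_global_solution:
  assumes "m > 1" "N \<ge> 2" "chi \<ge> 0" and neg: "\<exists>X. Rset N X \<and> Fm N m chi X < 0"
    and sol: "is_solution N m chi X0 \<infinity> X"
  shows False
proof -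
  define Q where "Q t = (\<Sum>i=1..N. (X t i)\<^sup>2)" for t
  define F where "F t = Fm N m chi (X t)" for t
  define P where "P t = (\<Sum>i=1..N. (rhs N m chi (X t) i)\<^sup>2)" for t
  have R: "Rset N (X t)" if "0 < t" for t
    using sol that by (simp add: is_solution_def)
  have dX: "((\<lambda>s. X s i) has_real_derivative rhs N m chi (X t) i) (at t)"
    if "0 < t" "i \<in> {1..N}" for t i
  proof -
    have "((\<lambda>s. X s i) has_real_derivative rhs N m chi (X t) i) (at t within {0..})"
      using sol that by (auto simp: is_solution_def atLeast_def)
    moreover have "at t within {0..} = at t"
      using that by (intro at_within_interior) simp
    ultimately show ?thesis by simp
  qed
  have Q_pos: "0 < Q t" if "0 < t" for t
    unfolding Q_def by (rule Rset_sum_squares_pos[OF R[OF that] assms(2)])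
  have dQ: "(Q has_real_derivative 2 * (m - 1) * F t) (at t)" if "0 < t" for t
  proof -
    have "(Q has_real_derivative (\<Sum>i=1..N. 2 * (X t i * rhs N m chi (X t) i))) (at t)"
      unfolding Q_def using dX[OF that] by (intro DERIV_sum) (auto intro!: derivative_eq_intros)
    moreover have "(\<Sum>i=1..N. 2 * (X t i * rhs N m chi (X t) i)) = 2 * (m - 1) * F t"
      unfolding sum_distrib_left[symmetric] rhs_Euler[OF R[OF that] assms(1)] F_def by simp
    ultimately show ?thesis by simp
  qed
  have dF: "(F has_real_derivative - P t) (at t)" if "0 < t" for t
    unfolding F_def P_def power2_eq_square
    by (rule Fm_has_derivative_along[OF R[OF that] assms(1) dX[OF that]])
  have F_le: "F t \<le> F s" if "0 < s" "s \<le> t" for s t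
  proof (rule DERIV_nonpos_imp_nonincreasing[OF that(2)])
    fix x assume "s \<le> x" "x \<le> t"
    then show "\<exists>y. DERIV F x :> y \<and> y \<le> 0"
      using dF[of x] that by (intro exI[of _ "- P x"]) (auto simp: P_def sum_nonneg)
  qed
  \<comment> \<open>A negative energy at time \<open>s\<close> persists, so \<open>Q\<close>
    decreases at rate at least \<open>a\<close> and would reach 0 no later than
    \<open>s + Q s / a\<close>.\<close>
  have F_nonneg: "0 \<le> F s" if s: "0 < s" for s
  proof (rule ccontr)
    assume "\<not> 0 \<le> F s"
    then have Fs: "F s < 0" by simp
    define a where "a = - (2 * (m - 1) * F s)"
    have a: "0 < a"
      using Fs assms(1) by (simp add: a_def mult_pos_neg)
    define t where "t = s + Q s / a"
    have st: "s \<le> t"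
      using Q_pos[OF s] a by (simp add: t_def)
    have "Q t + a * t \<le> Q s + a * s"
    proof (rule DERIV_nonpos_imp_nonincreasing[OF st])
      fix x assume x: "s \<le> x" "x \<le> t"
      have "((\<lambda>x. Q x + a * x) has_real_derivative 2 * (m - 1) * F x + a) (at x)"
        using dQ[of x] x s by (auto intro!: derivative_eq_intros)
      moreover have "2 * (m - 1) * F x + a \<le> 0"
        using mult_left_mono[OF F_le[OF s x(1)], of "2 * (m - 1)"] assms(1) by (simp add: a_def)
      ultimately show "\<exists>y. DERIV (\<lambda>x. Q x + a * x) x :> y \<and> y \<le> 0" by blast
    qed
    moreover have "a * t = a * s + Q s"
      using a by (simp add: t_def field_simps)
    ultimately have "Q t \<le> 0" by simp
    then show False
      using Q_pos[of t] st s by simp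
  qed
  obtain \<kappa> where \<kappa>: "0 < \<kappa>"
    "\<And>Y. Rset N Y \<Longrightarrow> 0 \<le> Fm N m chi Y \<Longrightarrow>
       \<kappa> * (\<Sum>i=1..N. (Y i)\<^sup>2) powr (- m)
         \<le> (\<Sum>i=1..N. (rhs N m chi Y i)\<^sup>2) - ((m - 1) * Fm N m chi Y)\<^sup>2 / (\<Sum>i=1..N. (Y i)\<^sup>2)"
    using neg spherical_gradient_lower_bound[OF assms(1-3)] by metis
  \<comment> \<open>In terms of |X|, \<open>G\<close> is |X|^(m-1) F, the energy of X/|X| by
    homogeneity, and \<open>W\<close> is |X|^(m+1). The exponents make the derivative of
    \<open>W\<close> a constant multiple of \<open>G\<close>.\<close>
  define G where "G t = Q t powr ((m - 1) / 2) * F t" for t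
  define W where "W t = Q t powr ((m + 1) / 2)" for t
  show False
  proof (rule no_eternal_solution_of_differential_inequalities[OF \<kappa>(1), of "m\<^sup>2 - 1" G W])
    show "0 \<le> m\<^sup>2 - 1"
      using assms(1) by simp
    fix t :: real assume t: "0 < t"
    note Qt = Q_pos[OF t]
    show "0 \<le> G t" "0 < W t"
      using F_nonneg[OF t] Qt by (auto simp: G_def W_def)
    note dpow = has_real_derivative_powr[THEN DERIV_chain2, OF Qt dQ[OF t]]
    have "(W has_real_derivative (m + 1) / 2 * Q t powr ((m + 1) / 2 - 1) * (2 * (m - 1) * F t)) (at t)"
      unfolding W_def by (rule dpow)
    moreover have "(m + 1) / 2 - 1 = (m - 1) / 2" by (simp add: field_simps)
    moreover have "(m + 1) / 2 * q * (2 * (m - 1) * F t) = (m\<^sup>2 - 1) * (q * F t)" for q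
      by (simp add: power2_eq_square field_simps)
    ultimately show "(W has_real_derivative (m\<^sup>2 - 1) * G t) (at t)"
      unfolding G_def by (simp only:)
    define q where "q = Q t powr ((m - 1) / 2)"
    have q: "Q t powr ((m - 1) / 2 - 1) = q / Q t"
      using Qt by (simp add: q_def powr_diff)
    have "(G has_real_derivative (m - 1) / 2 * (q / Q t) * (2 * (m - 1) * F t) * F t + - P t * q) (at t)"
      unfolding G_def using DERIV_mult[OF dpow dF[OF t], of "(m - 1) / 2"] by (simp only: q q_def[symmetric])
    moreover have "(m - 1) / 2 * (q / Q t) * (2 * (m - 1) * F t) * F t + - P t * q
        = - q * (P t - ((m - 1) * F t)\<^sup>2 / Q t)"
      using Qt by (simp add: field_simps power2_eq_square)
    moreover have "- q * (P t - ((m - 1) * F t)\<^sup>2 / Q t) \<le> - q * (\<kappa> * Q t powr (- m))"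
      using \<kappa>(2)[OF R[OF t]] F_nonneg[OF t] unfolding P_def F_def Q_def q_def
      by (intro mult_left_mono_neg) auto
    moreover have "- q * (\<kappa> * Q t powr (- m)) = - \<kappa> / W t"
    proof -
      have "q * Q t powr (- m) = Q t powr (- ((m + 1) / 2))"
      proof -
        have "(m - 1) / 2 + - m = - ((m + 1) / 2)" by (simp add: field_simps)
        then show ?thesis
          unfolding q_def powr_add[symmetric] by (simp only:)
      qed
      also have "\<dots> = 1 / W t"
        unfolding W_def by (rule powr_minus_divide)
      finally have *: "q * Q t powr (- m) = 1 / W t" .
      have "- q * (\<kappa> * Q t powr (- m)) = - \<kappa> * (q * Q t powr (- m))" by simp
      then show ?thesis
        unfolding * by simp
    qed
    ultimately have "(G has_real_derivative - q * (P t - ((m - 1) * F t)\<^sup>2 / Q t)) (at t)"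
      "- q * (P t - ((m - 1) * F t)\<^sup>2 / Q t) \<le> - \<kappa> / W t"
      by (simp_all only:)
    then show "\<exists>g. (G has_real_derivative g) (at t) \<and> g \<le> - \<kappa> / W t"
      by blast
  qed
qed

section \<open>Local existence and continuation\<close>

text \<open>Banach's fixed point theorem is applied to the integral operator:
  \<open>h * B \<le> r\<close> keeps curves in the ball, and \<open>h * L\<close> is the contraction
  factor.\<close>

lemma Picard_Lindelof:
  fixes f :: "'b::banach \<Rightarrow> 'b"
  assumes "0 < h" "0 \<le> L" "h * L < 1" "h * B \<le> r" "0 \<le> r"
    and lip: "\<And>x y. x \<in> cball x0 r \<Longrightarrow> y \<in> cball x0 r \<Longrightarrow> norm (f x - f y) \<le> L * norm (x - y)"
    and bound: "\<And>x. x \<in> cball x0 r \<Longrightarrow> norm (f x) \<le> B"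
  obtains u where "u 0 = x0" "\<And>t. u t \<in> cball x0 r"
    "\<And>t. t \<in> {0..h} \<Longrightarrow> (u has_vector_derivative f (u t)) (at t within {0..h})"
proof -
  define S :: "(real \<Rightarrow>\<^sub>C 'b) set" where "S = PiC UNIV (\<lambda>_. cball x0 r)"
  have "dist (f x) (f y) \<le> L * dist x y" if "x \<in> cball x0 r" "y \<in> cball x0 r" for x y
    using lip[OF that] by (simp add: dist_norm)
  then have "L-lipschitz_on (cball x0 r) f"
    using assms(2) by (intro lipschitz_onI)
  then have f_cont: "continuous_on (cball x0 r) f"
    by (rule lipschitz_on_continuous_on)
  have S_mem: "u t \<in> cball x0 r" if "u \<in> S" for u :: "real \<Rightarrow>\<^sub>C 'b" and t
    using that by (auto simp: S_def mem_PiC_iff)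
  have fu_cont: "continuous_on T (\<lambda>s. f (u s))" if "u \<in> S" for u :: "real \<Rightarrow>\<^sub>C 'b" and T
    using S_mem[OF that]
    by (intro continuous_on_compose2[OF f_cont continuous_on_apply_bcontfun]) auto
  have int: "(\<lambda>s. f (u s)) integrable_on {0..t}" if "u \<in> S" for u :: "real \<Rightarrow>\<^sub>C 'b" and t
    by (intro integrable_continuous_real fu_cont[OF that])
  \<comment> \<open>Clipping time to \<open>{0..h}\<close> makes the iterates bounded continuous
    functions on the whole line, hence members of a complete space.\<close>
  define c where "c t = max 0 (min h t)" for t :: real
  have c: "0 \<le> c t" "c t \<le> h" for t
    using assms(1) by (auto simp: c_def)
  define \<Phi> where "\<Phi> u t = x0 + integral {0..c t} (\<lambda>s. f (apply_bcontfun u s))" for u t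
  have \<Phi>_cball: "\<Phi> u t \<in> cball x0 r" if "u \<in> S" for u t
  proof -
    have "0 \<le> B"
      using bound[OF S_mem[OF that]] norm_ge_zero order_trans by blast
    have "norm (integral {0..c t} (\<lambda>s. f (u s))) \<le> B * (c t - 0)"
      using S_mem[OF that] bound c[of t] by (intro integral_bound fu_cont[OF that]) auto
    also have "\<dots> \<le> B * h"
      using c[of t] \<open>0 \<le> B\<close> by (intro mult_left_mono) auto
    finally show ?thesis
      using assms(4) by (simp add: \<Phi>_def dist_norm mult.commute)
  qed
  have \<Phi>_cont: "continuous_on UNIV (\<Phi> u)" if "u \<in> S" for u
  proof -
    have "continuous_on {0..h} (\<lambda>t. integral {0..t} (\<lambda>s. f (u s)))"
      by (intro indefinite_integral_continuous_1 int[OF that])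
    moreover have "continuous_on UNIV c"
      unfolding c_def by (intro continuous_intros)
    ultimately have "continuous_on UNIV (\<lambda>t. integral {0..c t} (\<lambda>s. f (u s)))"
      by (rule continuous_on_compose2[where g = "\<lambda>t. integral {0..t} (\<lambda>s. f (u s))"])
        (use c in auto)
    then show ?thesis
      unfolding \<Phi>_def by (intro continuous_intros)
  qed
  have \<Phi>_bcontfun: "\<Phi> u \<in> bcontfun" if "u \<in> S" for u
    unfolding bcontfun_def using \<Phi>_cont[OF that] \<Phi>_cball[OF that]
    by (auto intro: bounded_subset[OF bounded_cball[of x0 r]])
  define \<Psi> where "\<Psi> u = Bcontfun (\<Phi> u)" for u
  have \<Psi>: "apply_bcontfun (\<Psi> u) = \<Phi> u" if "u \<in> S" for u
    unfolding \<Psi>_def by (rule Bcontfun_inverse[OF \<Phi>_bcontfun[OF that]])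
  have "\<exists>!u\<in>S. \<Psi> u = u"
  proof (rule Banach_fix[where c = "h * L"])
    show "complete S"
      unfolding S_def complete_eq_closed by (intro closed_PiC) auto
    have "const_bcontfun x0 \<in> S"
      using assms(5) by (auto simp: S_def mem_PiC_iff const_bcontfun.rep_eq)
    then show "S \<noteq> {}" by blast
    show "0 \<le> h * L" "h * L < 1"
      using assms by auto
    show "\<Psi> ` S \<subseteq> S"
    proof
      fix w assume "w \<in> \<Psi> ` S"
      then obtain u where "u \<in> S" "w = \<Psi> u" by blast
      then show "w \<in> S"
        using \<Phi>_cball[of u] \<Psi>[of u] by (auto simp: S_def mem_PiC_iff)
    qed
    show "dist (\<Psi> u) (\<Psi> w) \<le> h * L * dist u w" if "u \<in> S" "w \<in> S" for u w
    proof (rule dist_bound)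
      fix t
      have "norm (f (u s) - f (w s)) \<le> L * dist u w" for s
      proof -
        have "norm (f (u s) - f (w s)) \<le> L * dist (u s) (w s)"
          using lip[OF S_mem[OF that(1)] S_mem[OF that(2)]] by (simp add: dist_norm)
        also have "\<dots> \<le> L * dist u w"
          using assms(2) by (intro mult_left_mono dist_bounded)
        finally show ?thesis .
      qed
      then have "norm (integral {0..c t} (\<lambda>s. f (u s) - f (w s))) \<le> L * dist u w * (c t - 0)"
        using c[of t] by (intro integral_bound continuous_intros fu_cont that) auto
      also have "\<dots> \<le> L * dist u w * h"
        using c[of t] assms(2) by (intro mult_left_mono) auto
      finally show "dist (apply_bcontfun (\<Psi> u) t) (apply_bcontfun (\<Psi> w) t) \<le> h * L * dist u w"
        using that by (simp add: \<Psi> \<Phi>_def dist_norm int mult_ac flip: integral_diff)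
    qed
  qed
  then obtain u where u: "u \<in> S" "\<Psi> u = u" by blast
  then have u_eq: "u t = \<Phi> u t" for t
    using \<Psi>[OF u(1)] by simp
  show ?thesis
  proof
    show "u 0 = x0"
      using u_eq[of 0] assms(1) by (simp add: \<Phi>_def c_def)
    show "u t \<in> cball x0 r" for t
      by (rule S_mem[OF u(1)])
    fix t assume t: "t \<in> {0..h}"
    have "((\<lambda>t. x0 + integral {0..t} (\<lambda>s. f (u s))) has_vector_derivative f (u t)) (at t within {0..h})"
      using integral_has_vector_derivative[OF fu_cont[OF u(1)] t] by (auto intro!: derivative_eq_intros)
    moreover have "u s = x0 + integral {0..s} (\<lambda>s. f (u s))" if "s \<in> {0..h}" for s
    proof -
      have cs: "c s = s" using that by (simp add: c_def)
      show ?thesis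
        using u_eq[of s] unfolding \<Phi>_def cs .
    qed
    ultimately show "(u has_vector_derivative f (u t)) (at t within {0..h})"
      by (rule has_vector_derivative_transform[OF t, rotated])
  qed
qed

section \<open>Bounds on the vector field away from collisions\<close>

text \<open>Mean value inequality: the derivative is largest in modulus at the left end of
  \<open>{d..}\<close>.\<close>

lemma powr_minus_lipschitz:
  fixes a b d m :: real
  assumes "0 < d" "0 < m" "d \<le> a" "d \<le> b"
  shows "\<bar>a powr (- m) - b powr (- m)\<bar> \<le> m * d powr (- m - 1) * \<bar>a - b\<bar>"
proof -
  have "norm (a powr (- m) - b powr (- m)) \<le> m * d powr (- m - 1) * norm (a - b)"
  proof (rule field_differentiable_bound[where S = "{d..}"])
    fix z assume z: "z \<in> {d..}"
    show "((\<lambda>z. z powr (- m)) has_field_derivative - m * z powr (- m - 1)) (at z within {d..})"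
      using z assms(1) has_real_derivative_powr[of z "- m"]
      by (auto intro: has_field_derivative_at_within)
    have "z powr (- m - 1) \<le> d powr (- m - 1)"
      using z assms by (intro powr_mono2') auto
    then show "norm (- m * z powr (- m - 1)) \<le> m * d powr (- m - 1)"
      using assms(2) by (simp add: abs_mult)
  qed (use assms in auto)
  then show ?thesis by simp
qed

text \<open>All pairs are included, since the interaction involves every distance. Centring is not
  imposed, so the condition makes sense for arbitrary points of a ball.\<close>

definition separated :: "nat \<Rightarrow> real \<Rightarrow> (nat \<Rightarrow> real) \<Rightarrow> bool" where
  "separated N d u \<longleftrightarrow> (\<forall>i\<in>{1..N}. \<forall>j\<in>{1..N}. i < j \<longrightarrow> d \<le> u j - u i)"

lemma separatedD:
  assumes "separated N d u" "i \<in> {1..N}" "j \<in> {1..N} - {i}"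
  shows "d \<le> \<bar>u j - u i\<bar>"
proof (cases "i < j")
  case True
  then show ?thesis
    using assms unfolding separated_def by fastforce
next
  case False
  then have "d \<le> u i - u j"
    using assms unfolding separated_def by (metis Diff_iff insertI1 linorder_neqE_nat)
  then show ?thesis by simp
qed

lemma separated_gap:
  assumes "separated N d u" "i \<in> {1..N}" "i < N"
  shows "d \<le> gap u i"
  using assms unfolding separated_def gap_def by auto

lemma gap_abs_eq: "d \<le> gap u i \<Longrightarrow> 0 < d \<Longrightarrow> gap u i = \<bar>u (Suc i) - u i\<bar>"
  by (simp add: gap_def)

text \<open>There are two local terms and at most \<open>N\<close> interaction terms, each at most
  \<open>d powr (- m)\<close> in modulus before the factor \<open>2 * chi\<close>.\<close>

lemma rhs_bound:
  assumes "0 < d" "0 < m" "separated N d u" "i \<in> {1..N}"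
  shows "\<bar>rhs N m chi u i\<bar> \<le> (2 + 2 * \<bar>chi\<bar> * real N) * d powr (- m)"
proof -
  define B where "B = d powr (- m)"
  have B: "0 \<le> B" by (simp add: B_def)
  have P: "x powr (- m) \<le> B" if "d \<le> x" for x
    unfolding B_def using that assms by (intro powr_mono2') auto
  have "\<bar>if i < N then - (gap u i powr (- m)) else 0\<bar> \<le> B"
    using separated_gap[OF assms(3,4)] P B by auto
  moreover have "\<bar>if 1 < i then gap u (i - 1) powr (- m) else 0\<bar> \<le> B"
    using separated_gap[OF assms(3), of "i - 1"] assms(4) P B by auto
  moreover have "\<bar>\<Sum>j\<in>{1..N} - {i}. sgn (real j - real i) * \<bar>u j - u i\<bar> powr (- m)\<bar> \<le> real N * B"
  proof -
    have "\<bar>\<Sum>j\<in>{1..N} - {i}. sgn (real j - real i) * \<bar>u j - u i\<bar> powr (- m)\<bar>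
        \<le> (\<Sum>j\<in>{1..N} - {i}. B)"
    proof (rule sum_abs[THEN order_trans], rule sum_mono)
      fix j assume "j \<in> {1..N} - {i}"
      then show "\<bar>sgn (real j - real i) * \<bar>u j - u i\<bar> powr (- m)\<bar> \<le> B"
        using P[OF separatedD[OF assms(3,4)]] by (simp add: abs_mult abs_sgn_eq)
    qed
    also have "\<dots> \<le> (\<Sum>j\<in>{1..N}. B)"
      using B by (intro sum_mono2) auto
    finally show ?thesis by simp
  qed
  then have "\<bar>2 * chi * (\<Sum>j\<in>{1..N} - {i}. sgn (real j - real i) * \<bar>u j - u i\<bar> powr (- m))\<bar>
      \<le> 2 * \<bar>chi\<bar> * (real N * B)"
    unfolding abs_mult by (intro mult_mono) auto
  ultimately have "\<bar>rhs N m chi u i\<bar> \<le> B + B + 2 * \<bar>chi\<bar> * (real N * B)"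
    unfolding rhs_def by linarith
  then show ?thesis
    by (simp add: B_def algebra_simps)
qed

text \<open>The terms are counted as in \<open>rhs_bound\<close>; the extra 2 appears because a
  distance changes by up to \<open>2 * e\<close> when coordinates change by
  \<open>e\<close>.\<close>

lemma rhs_lipschitz:
  assumes "0 < d" "0 < m" "separated N d u" "separated N d w" "i \<in> {1..N}"
    and e: "\<And>k. k \<in> {1..N} \<Longrightarrow> \<bar>u k - w k\<bar> \<le> e"
  shows "\<bar>rhs N m chi u i - rhs N m chi w i\<bar>
           \<le> (2 + 2 * \<bar>chi\<bar> * real N) * (2 * m * d powr (- m - 1)) * e"
proof -
  define B where "B = 2 * m * d powr (- m - 1) * e"
  have "0 \<le> e"
    using e[OF assms(5)] by linarith
  then have B: "0 \<le> B"
    using assms(2) by (simp add: B_def)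
  have P: "\<bar>\<bar>u j - u k\<bar> powr (- m) - \<bar>w j - w k\<bar> powr (- m)\<bar> \<le> B"
    if "k \<in> {1..N}" "j \<in> {1..N} - {k}" for j k
  proof -
    have "\<bar>\<bar>u j - u k\<bar> powr (- m) - \<bar>w j - w k\<bar> powr (- m)\<bar>
        \<le> m * d powr (- m - 1) * \<bar>\<bar>u j - u k\<bar> - \<bar>w j - w k\<bar>\<bar>"
      using separatedD[OF assms(3) that] separatedD[OF assms(4) that] assms(1,2)
      by (intro powr_minus_lipschitz)
    also have "\<dots> \<le> m * d powr (- m - 1) * (2 * e)"
      using e[of j] e[of k] that assms(2) by (intro mult_left_mono) auto
    finally show ?thesis by (simp add: B_def)
  qed
  have G: "\<bar>gap u k powr (- m) - gap w k powr (- m)\<bar> \<le> B" if "k \<in> {1..N}" "k < N" for k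
    unfolding gap_abs_eq[OF separated_gap[OF assms(3) that] assms(1)]
      gap_abs_eq[OF separated_gap[OF assms(4) that] assms(1)]
    using that by (intro P) auto
  have "\<bar>(if i < N then - (gap u i powr (- m)) else 0) - (if i < N then - (gap w i powr (- m)) else 0)\<bar> \<le> B"
    using G[OF assms(5)] B by auto
  moreover have "\<bar>(if 1 < i then gap u (i - 1) powr (- m) else 0)
      - (if 1 < i then gap w (i - 1) powr (- m) else 0)\<bar> \<le> B"
    using G[of "i - 1"] assms(5) B by auto
  moreover have "\<bar>(\<Sum>j\<in>{1..N} - {i}. sgn (real j - real i) * \<bar>u j - u i\<bar> powr (- m))
      - (\<Sum>j\<in>{1..N} - {i}. sgn (real j - real i) * \<bar>w j - w i\<bar> powr (- m))\<bar> \<le> real N * B"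
  proof -
    have "\<bar>\<Sum>j\<in>{1..N} - {i}. sgn (real j - real i) * \<bar>u j - u i\<bar> powr (- m)
          - sgn (real j - real i) * \<bar>w j - w i\<bar> powr (- m)\<bar>
        \<le> (\<Sum>j\<in>{1..N} - {i}. B)"
    proof (rule sum_abs[THEN order_trans], rule sum_mono)
      fix j assume "j \<in> {1..N} - {i}"
      then show "\<bar>sgn (real j - real i) * \<bar>u j - u i\<bar> powr (- m)
          - sgn (real j - real i) * \<bar>w j - w i\<bar> powr (- m)\<bar> \<le> B"
        unfolding right_diff_distrib[symmetric] abs_mult using P[OF assms(5)]
        by (simp add: abs_sgn_eq)
    qed
    also have "\<dots> \<le> (\<Sum>j\<in>{1..N}. B)"
      using B by (intro sum_mono2) auto
    finally show ?thesis by (simp add: sum_subtractf)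
  qed
  then have "\<bar>2 * chi * ((\<Sum>j\<in>{1..N} - {i}. sgn (real j - real i) * \<bar>u j - u i\<bar> powr (- m))
      - (\<Sum>j\<in>{1..N} - {i}. sgn (real j - real i) * \<bar>w j - w i\<bar> powr (- m)))\<bar>
      \<le> 2 * \<bar>chi\<bar> * (real N * B)"
    unfolding abs_mult by (intro mult_mono) auto
  ultimately have "\<bar>rhs N m chi u i - rhs N m chi w i\<bar> \<le> B + B + 2 * \<bar>chi\<bar> * (real N * B)"
    unfolding rhs_def right_diff_distrib by linarith
  then show ?thesis
    by (simp add: B_def algebra_simps)
qed

lemma rhs_cong:
  assumes "\<And>k. k \<in> {1..N} \<Longrightarrow> u k = w k" "i \<in> {1..N}"
  shows "rhs N m chi u i = rhs N m chi w i"
proof -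
  have prev: "u (i - 1) = w (i - 1)" if "1 < i"
    using that assms(2) by (intro assms(1)) auto
  have "(\<Sum>j\<in>{1..N} - {i}. sgn (real j - real i) * \<bar>u j - u i\<bar> powr (- m))
      = (\<Sum>j\<in>{1..N} - {i}. sgn (real j - real i) * \<bar>w j - w i\<bar> powr (- m))"
    using assms by (intro sum.cong) auto
  then show ?thesis
    using assms(1)[of "Suc i"] assms(1)[OF assms(2)] prev assms(2)
    by (auto simp: rhs_def gap_def)
qed

text \<open>As \<open>N\<close> is not a type, $R^N$ is realised in the Banach space of bounded functions on a
  discrete copy of \<open>nat\<close>. The type \<open>nat\<close> itself does not qualify, because completeness of
  \<open>bcontfun\<close> is only available over metric spaces.\<close>

definition restrict_bcontfun :: "nat \<Rightarrow> (nat \<Rightarrow> real) \<Rightarrow> nat discrete \<Rightarrow>\<^sub>C real" where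
  "restrict_bcontfun N x = Bcontfun (\<lambda>k. if of_discrete k \<in> {1..N} then x (of_discrete k) else 0)"

definition coord :: "(nat discrete \<Rightarrow>\<^sub>C real) \<Rightarrow> nat \<Rightarrow> real" where
  "coord u i = apply_bcontfun u (discrete i)"

text \<open>The truncated function is bounded since its range is finite, and continuous since its
  domain is discrete.\<close>

lemma apply_restrict_bcontfun:
  "apply_bcontfun (restrict_bcontfun N x) k
     = (if of_discrete k \<in> {1..N} then x (of_discrete k) else 0)"
proof -
  define g where "g k = (if of_discrete k \<in> {1..N} then x (of_discrete k) else 0)" for k
  have "range g \<subseteq> insert 0 (x ` {1..N})"
    by (auto simp: g_def)
  then have "finite (range g)"
    by (rule finite_subset) simp
  moreover have "continuous_on UNIV g"
    by (simp add: continuous_on_open_vimage open_discrete)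
  ultimately have "g \<in> bcontfun"
    by (auto simp: bcontfun_def intro: finite_imp_bounded)
  then have "apply_bcontfun (Bcontfun g) k = g k"
    by (simp add: Bcontfun_inverse)
  then show ?thesis
    by (simp add: restrict_bcontfun_def g_def[abs_def])
qed

lemma coord_restrict_bcontfun:
  "coord (restrict_bcontfun N x) i = (if i \<in> {1..N} then x i else 0)"
  by (simp add: coord_def apply_restrict_bcontfun discrete_inverse)

lemma bounded_linear_coord: "bounded_linear (\<lambda>u. coord u i)"
proof (rule bounded_linear_intro[of _ 1])
  show "norm (coord u i) \<le> norm u * 1" for u
    using norm_bounded[of u "discrete i"] by (simp add: coord_def)
qed (simp_all add: coord_def)

lemma abs_coord_diff_le_dist: "\<bar>coord u i - coord w i\<bar> \<le> dist u w"
  using dist_bounded[of u "discrete i" w] by (simp add: coord_def dist_real_def)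

instance bcontfun :: (metric_space, banach) banach ..

section \<open>Local solutions with a uniform existence time\<close>

text \<open>\<open>h\<close> precedes the initial datum: on a ball of radius
  \<open>\<delta> / 4\<close> around any admissible datum, points stay \<open>\<delta> / 2\<close>
  apart, so the bound and the Lipschitz constant depend only on \<open>\<delta>\<close>,
  \<open>N\<close>, \<open>m\<close> and \<open>chi\<close>.\<close>

lemma uniform_local_solution:
  assumes "0 < m" "0 < \<delta>"
  obtains h where "0 < h"
    "\<And>X. Rset N X \<Longrightarrow> (\<And>i. i \<in> {1..<N} \<Longrightarrow> \<delta> \<le> gap X i) \<Longrightarrow>
      \<exists>u. u 0 = X \<and> (\<forall>t\<in>{0..h}. Rset N (u t)) \<and>
        (\<forall>t\<in>{0..h}. \<forall>i\<in>{1..N}.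
           ((\<lambda>s. u s i) has_real_derivative rhs N m chi (u t) i) (at t within {0..h}))"
proof -
  define d where "d = \<delta> / 2"
  define r where "r = \<delta> / 4"
  define C where "C = 2 + 2 * \<bar>chi\<bar> * real N"
  define B where "B = C * d powr (- m)"
  define L where "L = C * (2 * m * d powr (- m - 1))"
  \<comment> \<open>The added ones avoid division by 0 and make \<open>h * L < 1\<close>
    strict.\<close>
  define h where "h = min (r / (B + 1)) (1 / (L + 1))"
  have d: "0 < d" and r: "0 < r" and C: "0 < C"
    using assms(2) by (auto simp: d_def r_def C_def intro: add_pos_nonneg)
  have B: "0 \<le> B" and L: "0 \<le> L"
    using C assms(1) by (auto simp: B_def L_def)
  have h: "0 < h"
    using r B L by (simp add: h_def)
  have "h * B \<le> r / (B + 1) * (B + 1)"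
    using h B by (intro mult_mono) (auto simp: h_def)
  then have hB: "h * B \<le> r"
    using B by simp
  have "h * L \<le> 1 / (L + 1) * L"
    using L by (intro mult_right_mono) (auto simp: h_def)
  also have "\<dots> < 1"
    using L by simp
  finally have hL: "h * L < 1" .
  have "\<exists>u. u 0 = X \<and> (\<forall>t\<in>{0..h}. Rset N (u t)) \<and>
        (\<forall>t\<in>{0..h}. \<forall>i\<in>{1..N}.
           ((\<lambda>s. u s i) has_real_derivative rhs N m chi (u t) i) (at t within {0..h}))"
    if X: "Rset N X" and gaps: "\<And>i. i \<in> {1..<N} \<Longrightarrow> \<delta> \<le> gap X i" for X
  proof -
    define f where "f u = restrict_bcontfun N (rhs N m chi (coord u))" for u
    define x0 where "x0 = restrict_bcontfun N X"
    have x0: "coord x0 = X"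
      using X by (auto simp: x0_def coord_restrict_bcontfun Rset_def)
    have sep: "separated N d (coord u)" if u: "u \<in> cball x0 r" for u
      unfolding separated_def
    proof (intro ballI impI)
      fix i j assume ij: "i \<in> {1..N}" "j \<in> {1..N}" "i < j"
      have "\<delta> \<le> gap X i"
        using ij by (intro gaps) auto
      also have "gap X i \<le> X j - X i"
        using Rset_strict_mono[OF X, of "Suc i" j] ij
        by (cases "j = Suc i") (auto simp: gap_def less_eq_real_def)
      finally have "\<delta> \<le> X j - X i" .
      \<comment> \<open>Each of the two coordinates moves by at most \<open>\<delta> / 4\<close>, so
        a difference loses at most half of \<open>\<delta>\<close>.\<close>
      moreover have "\<bar>X k - coord u k\<bar> \<le> r" for k
        using abs_coord_diff_le_dist[of x0 k u] u by (simp add: x0)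
      from this[of i] this[of j] have "(X j - X i) - (coord u j - coord u i) \<le> 2 * r" by linarith
      ultimately show "d \<le> coord u j - coord u i"
        by (simp add: d_def r_def)
    qed
    have lip: "norm (f u - f w) \<le> L * norm (u - w)" if "u \<in> cball x0 r" "w \<in> cball x0 r" for u w
    proof -
      have "dist (f u) (f w) \<le> L * dist u w"
      proof (rule dist_bound)
        fix k
        have "\<bar>rhs N m chi (coord u) i - rhs N m chi (coord w) i\<bar> \<le> L * dist u w"
          if i: "i \<in> {1..N}" for i
          unfolding L_def C_def using sep \<open>u \<in> cball x0 r\<close> \<open>w \<in> cball x0 r\<close>
          by (intro rhs_lipschitz[OF d assms(1) _ _ i] abs_coord_diff_le_dist)
        then show "dist (f u k) (f w k) \<le> L * dist u w"
          using L by (auto simp: f_def apply_restrict_bcontfun dist_real_def)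
      qed
      then show ?thesis by (simp add: dist_norm)
    qed
    have bound: "norm (f u) \<le> B" if "u \<in> cball x0 r" for u
    proof (rule norm_bound)
      show "norm (f u k) \<le> B" for k
        using rhs_bound[OF d assms(1) sep[OF that], of "of_discrete k" chi] B
        by (auto simp: f_def apply_restrict_bcontfun B_def C_def)
    qed
    obtain u where u: "u 0 = x0" "\<And>t. u t \<in> cball x0 r"
      "\<And>t. t \<in> {0..h} \<Longrightarrow> (u has_vector_derivative f (u t)) (at t within {0..h})"
      by (rule Picard_Lindelof[of h L B r x0 f]) (use h L hL hB r lip bound in auto)
    \<comment> \<open>The value 0 outside \<open>{1..N}\<close> is the convention of
      \<open>Rset\<close>.\<close>
    define v where "v t i = (if i \<in> {1..N} then coord (u t) i else 0)" for t i
    have rhs_v: "rhs N m chi (v t) i = rhs N m chi (coord (u t)) i" if "i \<in> {1..N}" for t i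
      using that by (intro rhs_cong) (auto simp: v_def)
    have dv: "((\<lambda>s. v s i) has_real_derivative rhs N m chi (v t) i) (at t within {0..h})"
      if "t \<in> {0..h}" "i \<in> {1..N}" for t i
      using bounded_linear.has_vector_derivative[OF bounded_linear_coord[of i] u(3)[OF that(1)]]
        that(2) rhs_v[OF that(2)]
      by (simp add: v_def f_def coord_restrict_bcontfun has_real_derivative_iff_has_vector_derivative)
    have v0: "v 0 = X"
      using u(1) x0 X by (auto simp: v_def Rset_def)
    \<comment> \<open>The centre of mass is conserved by \<open>sum_rhs\<close>.\<close>
    have "\<exists>c. \<forall>t\<in>{0..h}. (\<Sum>i=1..N. v t i) = c"
    proof (rule has_field_derivative_zero_constant)
      fix t assume t: "t \<in> {0..h}"
      have "((\<lambda>t. \<Sum>i=1..N. v t i) has_real_derivative (\<Sum>i=1..N. rhs N m chi (v t) i)) (at t within {0..h})"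
        by (intro DERIV_sum dv t)
      then show "((\<lambda>t. \<Sum>i=1..N. v t i) has_real_derivative 0) (at t within {0..h})"
        by (simp only: sum_rhs)
    qed simp
    moreover have "(\<Sum>i=1..N. v 0 i) = 0"
      using X by (simp add: v0 Rset_def)
    ultimately have v_sum: "(\<Sum>i=1..N. v t i) = 0" if "t \<in> {0..h}" for t
      using that h by (metis atLeastAtMost_iff less_imp_le order_refl)
    have "Rset N (v t)" if "t \<in> {0..h}" for t
      unfolding Rset_def
    proof (intro conjI ballI allI impI)
      fix i assume "i \<in> {1..<N}"
      then show "v t i < v t (Suc i)"
        using separated_gap[OF sep[OF u(2)], of i t] d by (auto simp: v_def gap_def)
    qed (use v_sum[OF that] in \<open>auto simp: v_def\<close>)
    then show ?thesis
      using v0 dv by blast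
  qed
  with h show ?thesis
    by (rule that)
qed

section \<open>Continuation and blow-up at a finite maximal time\<close>

text \<open>The autonomous equation allows a time shift. At \<open>t0\<close> both one-sided
  derivatives equal \<open>rhs\<close> of the common value \<open>X t0\<close>.\<close>

lemma is_solution_extend:
  assumes sol: "is_solution N m chi X0 (ereal T) X"
    and t0: "0 \<le> t0" "t0 < T" and h: "0 < h"
    and u: "u 0 = X t0" "\<And>t. t \<in> {0..h} \<Longrightarrow> Rset N (u t)"
      "\<And>t i. t \<in> {0..h} \<Longrightarrow> i \<in> {1..N} \<Longrightarrow>
         ((\<lambda>s. u s i) has_real_derivative rhs N m chi (u t) i) (at t within {0..h})"
  shows "is_solution N m chi X0 (ereal (t0 + h)) (\<lambda>t. if t \<le> t0 then X t else u (t - t0))"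
proof -
  define g where "g t = (if t \<le> t0 then X t else u (t - t0))" for t
  define A where "A = {0..t0}"
  \<comment> \<open>The right end is excluded to match the half-open time domain in
    \<open>is_solution\<close>.\<close>
  define B where "B = {t0..<t0 + h}"
  have dom: "{s. 0 \<le> s \<and> ereal s < ereal (t0 + h)} = A \<union> B"
    using t0 h by (auto simp: A_def B_def)
  have g_B: "g t = u (t - t0)" if "t \<in> B" for t
    using that u(1) by (cases "t = t0") (auto simp: g_def B_def)
  have dA: "((\<lambda>s. g s i) has_real_derivative rhs N m chi (g t) i) (at t within A)"
    if t: "t \<in> A" and i: "i \<in> {1..N}" for t i
  proof -
    have "((\<lambda>s. X s i) has_real_derivative rhs N m chi (X t) i) (at t within {s. 0 \<le> s \<and> ereal s < ereal T})"
      using sol t i t0 by (auto simp: is_solution_def A_def)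
    then have "((\<lambda>s. X s i) has_real_derivative rhs N m chi (X t) i) (at t within A)"
      by (rule has_field_derivative_subset) (use t0 in \<open>auto simp: A_def\<close>)
    from has_field_derivative_transform_within[OF this zero_less_one t, of "\<lambda>s. g s i"]
    show ?thesis
      using t by (auto simp: g_def A_def)
  qed
  have dB: "((\<lambda>s. g s i) has_real_derivative rhs N m chi (g t) i) (at t within B)"
    if t: "t \<in> B" and i: "i \<in> {1..N}" for t i
  proof -
    have "((\<lambda>s. u s i) has_real_derivative rhs N m chi (u (t - t0)) i) (at (t - t0) within {0..h})"
      using t i by (intro u(3)) (auto simp: B_def)
    then have "((\<lambda>s. u s i) has_real_derivative rhs N m chi (u (t - t0)) i)
        (at (t - t0) within (\<lambda>s. s - t0) ` B)"
      by (rule has_field_derivative_subset) (auto simp: B_def)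
    moreover have "((\<lambda>s. s - t0) has_real_derivative 1) (at t within B)"
      by (auto intro!: derivative_eq_intros)
    ultimately have "((\<lambda>s. u s i) \<circ> (\<lambda>s. s - t0) has_real_derivative rhs N m chi (u (t - t0)) i * 1)
        (at t within B)"
      by (rule DERIV_image_chain)
    then have "((\<lambda>s. u (s - t0) i) has_real_derivative rhs N m chi (g t) i) (at t within B)"
      by (simp add: o_def g_B[OF t])
    from has_field_derivative_transform_within[OF this zero_less_one t, of "\<lambda>s. g s i"]
    show ?thesis
      using g_B by simp
  qed
  have "((\<lambda>s. g s i) has_real_derivative rhs N m chi (g t) i) (at t within A \<union> B)"
    if t: "t \<in> A \<union> B" and i: "i \<in> {1..N}" for t i
  proof (cases t t0 rule: linorder_cases)
    case less
    then have "at t within A \<union> B = at t within A"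
      using t by (intro at_within_nhd[of _ "{..<t0}"]) (auto simp: A_def B_def)
    then show ?thesis
      using dA[of t i] less t i by (simp add: A_def B_def)
  next
    case equal
    then have "t \<in> A" "t \<in> B"
      using t0 h by (auto simp: A_def B_def)
    then show ?thesis
      using dA[of t i] dB[of t i] i unfolding has_field_derivative_iff Lim_within_Un by blast
  next
    case greater
    then have "at t within A \<union> B = at t within B"
      using t by (intro at_within_nhd[of _ "{t0<..}"]) (auto simp: A_def B_def)
    then show ?thesis
      using dB[of t i] greater t i by (simp add: A_def B_def)
  qed
  moreover have "Rset N (g t)" if "0 \<le> t" "t < t0 + h" for t
    using that sol t0 u(2)[of "t - t0"] by (auto simp: g_def is_solution_def)
  moreover have "g 0 = X0"
    using sol t0 by (simp add: g_def is_solution_def)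
  ultimately have "is_solution N m chi X0 (ereal (t0 + h)) g"
    unfolding is_solution_def dom[symmetric] using t0 h by auto
  then show ?thesis
    unfolding g_def[abs_def] .
qed

text \<open>Without blow-up all gaps have a common lower bound near \<open>T\<close>. Restarting
  less than the corresponding uniform existence time before \<open>T\<close> would then carry the
  solution beyond \<open>T\<close>, against maximality.\<close>

lemma blows_up_if_finite:
  assumes "0 < m" and max: "maximal_solution N m chi X0 (ereal T) X"
  shows "blows_up N (ereal T) X"
proof (rule ccontr)
  assume no: "\<not> blows_up N (ereal T) X"
  have sol: "is_solution N m chi X0 (ereal T) X"
    using max by (simp add: maximal_solution_def)
  then have T: "0 < T"
    by (simp add: is_solution_def)
  have R: "Rset N (X t)" if "0 \<le> t" "t < T" for t
    using sol that by (simp add: is_solution_def)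
  \<comment> \<open>If this failed, times within 1/(n+1) of \<open>T\<close> with gap below 1/(n+1)
    would form a blow-up sequence.\<close>
  have "\<exists>d>0. eventually (\<lambda>t. d \<le> gap (X t) i) (at_left T)" if i: "i \<in> {1..<N}" for i
  proof (rule ccontr)
    assume not_ev: "\<not> ?thesis"
    have "\<exists>t>max 0 (T - inverse (real (Suc n))). t < T \<and> gap (X t) i < inverse (real (Suc n))" for n
    proof -
      have "\<not> eventually (\<lambda>t. inverse (real (Suc n)) \<le> gap (X t) i) (at_left T)"
        using not_ev by (metis inverse_positive_iff_positive of_nat_0_less_iff zero_less_Suc)
      moreover have "max 0 (T - inverse (real (Suc n))) < T"
        using T by simp
      ultimately show ?thesis
        unfolding eventually_at_left_field by (metis not_le)
    qed
    then obtain tn where tn: "\<And>n. max 0 (T - inverse (real (Suc n))) < tn n" "\<And>n. tn n < T"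
      "\<And>n. gap (X (tn n)) i < inverse (real (Suc n))"
      by metis
    have "(\<lambda>n. T - inverse (real (Suc n))) \<longlonglongrightarrow> T - 0"
      by (intro tendsto_diff tendsto_const LIMSEQ_inverse_real_of_nat)
    then have "tn \<longlonglongrightarrow> T"
      using tn by (intro real_tendsto_sandwich[of "\<lambda>n. T - inverse (real (Suc n))" tn sequentially "\<lambda>_. T"])
        (auto intro!: always_eventually less_imp_le)
    then have "(\<lambda>n. ereal (tn n)) \<longlonglongrightarrow> ereal T"
      by simp
    moreover have "(\<lambda>n. gap (X (tn n)) i) \<longlonglongrightarrow> 0"
    proof (rule real_tendsto_sandwich[OF _ _ tendsto_const LIMSEQ_inverse_real_of_nat])
      show "\<forall>\<^sub>F n in sequentially. 0 \<le> gap (X (tn n)) i"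
        using tn Rset_gap_pos[OF R i] by (auto intro!: always_eventually less_imp_le)
      show "\<forall>\<^sub>F n in sequentially. gap (X (tn n)) i \<le> inverse (real (Suc n))"
        using tn(3) by (auto intro!: always_eventually less_imp_le)
    qed
    moreover have "\<forall>n. 0 \<le> tn n \<and> ereal (tn n) < ereal T"
      using tn by (auto intro: less_imp_le)
    ultimately show False
      using no i unfolding blows_up_def by blast
  qed
  then obtain d where d: "\<And>i. i \<in> {1..<N} \<Longrightarrow> 0 < d i"
    "\<And>i. i \<in> {1..<N} \<Longrightarrow> eventually (\<lambda>t. d i \<le> gap (X t) i) (at_left T)"
    by metis
  \<comment> \<open>Inserting 1 makes the set nonempty, so that \<open>Min\<close> is meaningful for
    every \<open>N\<close>.\<close>
  define \<delta> where "\<delta> = Min (insert 1 (d ` {1..<N}))"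
  have \<delta>: "0 < \<delta>"
    using d(1) by (simp add: \<delta>_def)
  have "eventually (\<lambda>t. \<delta> \<le> gap (X t) i) (at_left T)" if i: "i \<in> {1..<N}" for i
  proof -
    have "\<delta> \<le> d i"
      unfolding \<delta>_def using i by (intro Min_le) auto
    then show ?thesis
      by (intro eventually_mono[OF d(2)[OF i]]) linarith
  qed
  then have "eventually (\<lambda>t. \<forall>i\<in>{1..<N}. \<delta> \<le> gap (X t) i) (at_left T)"
    by (intro eventually_ball_finite) auto
  then obtain b where b: "b < T" "\<And>t. b < t \<Longrightarrow> t < T \<Longrightarrow> \<forall>i\<in>{1..<N}. \<delta> \<le> gap (X t) i"
    unfolding eventually_at_left_field by blast
  obtain h where h: "0 < h"
    "\<And>X. Rset N X \<Longrightarrow> (\<And>i. i \<in> {1..<N} \<Longrightarrow> \<delta> \<le> gap X i) \<Longrightarrow>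
      \<exists>u. u 0 = X \<and> (\<forall>t\<in>{0..h}. Rset N (u t)) \<and>
        (\<forall>t\<in>{0..h}. \<forall>i\<in>{1..N}.
           ((\<lambda>s. u s i) has_real_derivative rhs N m chi (u t) i) (at t within {0..h}))"
    using uniform_local_solution[OF assms(1) \<delta>, of N chi] by blast
  obtain t0 where t0: "max 0 (max b (T - h)) < t0" "t0 < T"
    using dense[of "max 0 (max b (T - h))" T] T b(1) h(1) by auto
  obtain u where u: "u 0 = X t0" "\<forall>t\<in>{0..h}. Rset N (u t)"
    "\<forall>t\<in>{0..h}. \<forall>i\<in>{1..N}.
       ((\<lambda>s. u s i) has_real_derivative rhs N m chi (u t) i) (at t within {0..h})"
    using h(2)[of "X t0"] R[of t0] b(2)[of t0] t0 by auto
  have "is_solution N m chi X0 (ereal (t0 + h)) (\<lambda>t. if t \<le> t0 then X t else u (t - t0))"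
    using sol t0 h(1) u by (intro is_solution_extend) auto
  then have "ereal (t0 + h) \<le> ereal T"
    using max unfolding maximal_solution_def by blast
  then show False
    using t0 by simp
qed

theorem theorem1p4:
  fixes m chi :: real and N :: nat and X0 :: "nat \<Rightarrow> real"
    and X :: "real \<Rightarrow> nat \<Rightarrow> real" and T :: ereal
  assumes "m > 1" and "N \<ge> 2" and "chi > Cconst N m" and "Rset N X0"
    and "maximal_solution N m chi X0 T X"
  shows "((\<forall>p\<in>{2..<N}. chi \<noteq> Cconst p m) \<longrightarrow> blows_up N T X \<and> T < \<infinity>)
    \<and> (\<forall>p\<in>{2..<N}. chi = Cconst p m \<longrightarrow>
         (blows_up N T X \<and> T < \<infinity>)
       \<or> (T = \<infinity> \<and> blows_up N \<infinity> (renorm N X)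
          \<and> (\<forall>tn :: nat \<Rightarrow> real. \<forall>l r.
               filterlim tn at_top sequentially \<and> (\<forall>n. 0 \<le> tn n)
               \<and> rel_blowup_set N (\<lambda>n. renorm N X (tn n)) l r \<longrightarrow>
                 r - l + 1 = p
                 \<and> (\<exists>Z. limit_profile (\<lambda>n. renorm N X (tn n)) l r Z
                        \<and> gap_normalized p Z \<and> critical_point p m chi Z
                        \<and> (\<forall>W. critical_point p m chi W \<and> gap_normalized p W \<longrightarrow> W = Z)))))"
proof -
  have sol: "is_solution N m chi X0 T X"
    using assms(5) by (simp add: maximal_solution_def)
  have "T \<noteq> \<infinity>"
    using no_global_solution[OF assms(1,2), of chi X0 X]
      exists_negative_energy[OF assms(1-4)] sol by auto
  moreover have "0 < T"
    using sol by (simp add: is_solution_def)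
  ultimately obtain T' where T': "T = ereal T'"
    by (cases T) auto
  then have "blows_up N T X" "T < \<infinity>"
    using blows_up_if_finite[of m N chi X0 T' X] assms(1,5) by auto
  \<comment> \<open>Finite-time blow-up is the conclusion of the first implication and, for every
    \<open>p\<close>, the first alternative of the second.\<close>
  then show ?thesis by blast
qed

end
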